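(* Let $a,c,\eta\in\mathbb R$ with $0<a<c$ and $c^2>\frac{4a(a+1)^3}{27}$, and consider on mean-zero $2\pi$-periodic pairs $(u,v)$ the system $$\partial_tu-\partial_xv=-a\,\partial_x^4u,\qquad \partial_tv-\partial_x\sigma(u)=-\delta\,\partial_x^2v-\partial_x^4v,\qquad \sigma(u)=c^2u+\tfrac12u^2+\tfrac\eta3u^3,$$ with bifurcation parameter $\delta$. Put $\delta_c=a+1$, $\omega=\sqrt{c^2-a^2}$. Then the $O(2)$-Hopf normal form coefficients $\zeta,\xi$ of this system at $\delta=\delta_c$ (critical wavenumber $m_c=1$; see context, with the eigenvector normalization given there) are $$\zeta=\frac{1}{12c^2\bigl[2(a+1)(a^2-c^2)+i\omega a(16-5a)\bigr]}+\frac{i\eta}{2c^2\omega},\qquad \xi=\frac{i}{c^2\omega}\left[\eta-\frac{1}{2\bigl(c^2-16a(a-3)\bigr)}\right].$$ In particular $$\operatorname{Re}\zeta=-\frac{a+1}{6c^2\bigl[a^2(5a-16)^2+4(a+1)^2(c^2-a^2)\bigr]}<0,\qquad \operatorname{Re}\xi=0,$$ so that $\operatorname{Re}\zeta+\operatorname{Re}\xi<0$ and $\operatorname{Re}\zeta-\operatorname{Re}\xi<0$ for all admissible $(a,c,\eta)$; consequently the traveling waves are saddles and the standing waves are stable.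
   Context: The linear part of the system on the Fourier mode $e^{imx}$, $m\in\mathbb Z\setminus\{0\}$, is $M_m(\delta)=\begin{pmatrix}-am^4&im\\ ic^2m&\delta m^2-m^4\end{pmatrix}$. At $\delta=\delta_c$, $M_1$ has eigenvalues $\beta_{1,1}=i\omega$, $\beta_{1,2}=-i\omega$, all other modes $m\neq0,\pm1$ have eigenvalues in the open left half plane bounded away from the imaginary axis, and there is a four-dimensional local center manifold for $\delta$ near $\delta_c$. The critical eigenvectors are normalized as $$\mathbf q_{1,n}=\begin{bmatrix}\dfrac{i}{a+\beta_{1,n}}\\1\end{bmatrix},\qquad n=1,2.$$ Writing the projection of a real solution onto the critical modes as $A e^{ix}\mathbf q_{1,1}+Be^{ix}\mathbf q_{1,2}+\mathrm{c.c.}$, the flow on the center manifold is brought, by a near-identity change of coordinates $Z_1=A+O(|(A,B)|^3)$, $Z_2=B+O(|(A,B)|^3)$ equivariant under the $O(2)$-action generated by $(u,v)(x)\mapsto(u,v)(x+h)$ and $(u,v)(x)\mapsto(u(-x),-v(-x))$, into the normal form $$\dot Z_1=\beta_{1,1}(\delta)Z_1+Z_1(\zeta|Z_1|^2+\xi|Z_2|^2)+O(|\delta-\delta_c||Z|^3+|Z|^5),\quad \dot Z_2=\beta_{1,2}(\delta)Z_2+Z_2(\bar\xi|Z_1|^2+\bar\zeta|Z_2|^2)+O(|\delta-\delta_c||Z|^3+|Z|^5);$$ this defines $\zeta$ and $\xi$ (evaluated at $\delta_c$). For the cubic truncation, a traveling wave is the solution $(Z_1,Z_2)=(re^{i\theta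 t},0)$ with $r^2=-\operatorname{Re}\beta_{1,1}/\operatorname{Re}\zeta>0$, and a standing wave is $(Z_1,Z_2)=r(e^{i\theta t},e^{-i\theta t})$ with $r^2=-\operatorname{Re}\beta_{1,1}/(\operatorname{Re}\zeta+\operatorname{Re}\xi)>0$. Their type (stable, saddle, unstable) is that of the corresponding equilibrium of the amplitude equations $\dot r_1=\operatorname{Re}\beta_{1,1}r_1+r_1(\operatorname{Re}\zeta\, r_1^2+\operatorname{Re}\xi\, r_2^2)$, $\dot r_2=\operatorname{Re}\beta_{1,1}r_2+r_2(\operatorname{Re}\xi\, r_1^2+\operatorname{Re}\zeta\, r_2^2)$, where $r_j=|Z_j|$. *)

theory Defs
  imports "HOL-Analysis.Analysis"
begin

section \<open>The system\<close>

text \<open>Class \<open>C\<^sup>k\<close> for maps on an open subset of a finite-dimensional space: all directional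
  derivatives of order at most \<open>k\<close> exist as Frechet derivatives and are continuous.\<close>

fun class_C :: "nat \<Rightarrow> 'a::real_normed_vector set \<Rightarrow> ('a \<Rightarrow> 'b::real_normed_vector) \<Rightarrow> bool" where
  "class_C 0 S f \<longleftrightarrow> continuous_on S f"
| "class_C (Suc k) S f \<longleftrightarrow>
     (\<forall>x\<in>S. f differentiable (at x)) \<and> (\<forall>v. class_C k S (\<lambda>x. frechet_derivative f (at x) v))"

definition flux :: "real \<Rightarrow> real \<Rightarrow> real \<Rightarrow> real" where
  "flux c \<eta> u = c\<^sup>2 * u + u\<^sup>2 / 2 + \<eta> / 3 * u ^ 3"

definition periodic_mean_zero :: "(real \<Rightarrow> real) \<Rightarrow> bool" where
  "periodic_mean_zero u \<longleftrightarrow>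
     class_C 4 UNIV u \<and> (\<forall>x. u (x + 2 * pi) = u x) \<and> integral {0..2 * pi} u = 0"

text \<open>Classical solutions on a set \<open>T\<close> of times; the profiles at time \<open>t\<close> are \<open>u t\<close> and \<open>v t\<close>.\<close>

definition solves_system ::
    "real \<Rightarrow> real \<Rightarrow> real \<Rightarrow> real \<Rightarrow> real set \<Rightarrow> (real \<Rightarrow> real \<Rightarrow> real) \<Rightarrow> (real \<Rightarrow> real \<Rightarrow> real) \<Rightarrow> bool" where
  "solves_system a c \<eta> \<delta> T u v \<longleftrightarrow>
     (\<forall>t\<in>T. periodic_mean_zero (u t) \<and> periodic_mean_zero (v t) \<and>
       (\<forall>x. ((\<lambda>s. u s x) has_real_derivative
               deriv (v t) x - a * (deriv ^^ 4) (u t) x) (at t) \<and>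
            ((\<lambda>s. v s x) has_real_derivative
               deriv (\<lambda>y. flux c \<eta> (u t y)) x - \<delta> * (deriv ^^ 2) (v t) x - (deriv ^^ 4) (v t) x) (at t)))"


section \<open>Linearization and critical modes\<close>

definition mode_matrix :: "real \<Rightarrow> real \<Rightarrow> real \<Rightarrow> int \<Rightarrow> complex^2^2" where
  "mode_matrix a c \<delta> m = vector
     [vector [- of_real a * of_int m ^ 4, \<i> * of_int m],
      vector [\<i> * (of_real c)\<^sup>2 * of_int m, of_real \<delta> * (of_int m)\<^sup>2 - of_int m ^ 4]]"

definition eigenvalue :: "complex^2^2 \<Rightarrow> complex \<Rightarrow> bool" where
  "eigenvalue M \<mu> \<longleftrightarrow> (\<exists>w. w \<noteq> 0 \<and> M *v w = \<mu> *s w)"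

text \<open>The continuations of the critical eigenvalues \<open>\<plusminus>i\<omega>\<close> of the first mode: near criticality this
  mode has exactly one eigenvalue in each of the open upper and lower half planes.\<close>

definition beta1 :: "real \<Rightarrow> real \<Rightarrow> real \<Rightarrow> complex" where
  "beta1 a c \<delta> = (THE \<beta>. eigenvalue (mode_matrix a c \<delta> 1) \<beta> \<and> Im \<beta> > 0)"

definition beta2 :: "real \<Rightarrow> real \<Rightarrow> real \<Rightarrow> complex" where
  "beta2 a c \<delta> = (THE \<beta>. eigenvalue (mode_matrix a c \<delta> 1) \<beta> \<and> Im \<beta> < 0)"

definition critical_vector :: "real \<Rightarrow> complex \<Rightarrow> complex^2" where
  "critical_vector a \<beta> = vector [\<i> / (of_real a + \<beta>), 1]"

text \<open>The vector \<open>A q\<^sub>1\<^sub>,\<^sub>1 + B q\<^sub>1\<^sub>,\<^sub>2\<close>, for \<open>z = (A, B)\<close>.\<close>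

definition critical_amplitude :: "real \<Rightarrow> real \<Rightarrow> real \<Rightarrow> complex \<times> complex \<Rightarrow> complex^2" where
  "critical_amplitude a c \<delta> z =
     fst z *s critical_vector a (beta1 a c \<delta>) + snd z *s critical_vector a (beta2 a c \<delta>)"

definition fourier_coeff :: "(real \<Rightarrow> real) \<Rightarrow> int \<Rightarrow> complex" where
  "fourier_coeff u m =
     integral {0..2 * pi} (\<lambda>x. of_real (u x) * cis (- (of_int m * x))) / of_real (2 * pi)"


section \<open>Center manifold\<close>

text \<open>The center manifold over \<open>\<bar>\<delta> - \<delta>\<^sub>c\<bar> < \<rho>\<close>, \<open>\<bar>(A, B)\<bar> < \<rho>\<close> is parametrized by the critical
  amplitudes \<open>z = (A, B)\<close>: its point with parameters \<open>\<delta>, z\<close> is the pair of profiles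
  \<open>(U \<delta> z, V \<delta> z)\<close>.  A curve \<open>z\<close> is a solution of the reduced flow if its lift to the manifold
  solves the system.\<close>

definition reduced_solution ::
    "real \<Rightarrow> real \<Rightarrow> real \<Rightarrow> real \<Rightarrow> (real \<Rightarrow> complex \<times> complex \<Rightarrow> real \<Rightarrow> real) \<Rightarrow>
     (real \<Rightarrow> complex \<times> complex \<Rightarrow> real \<Rightarrow> real) \<Rightarrow> real \<Rightarrow> real set \<Rightarrow> (real \<Rightarrow> complex \<times> complex) \<Rightarrow> bool" where
  "reduced_solution a c \<eta> \<rho> U V \<delta> T z \<longleftrightarrow>
     (\<forall>t\<in>T. z t \<in> ball 0 \<rho> \<and> z differentiable (at t)) \<and>
     solves_system a c \<eta> \<delta> T (\<lambda>t. U \<delta> (z t)) (\<lambda>t. V \<delta> (z t))"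

text \<open>The \<open>O(2)\<close>-action in the coordinates \<open>(A, B)\<close>: translation by \<open>h\<close> multiplies both amplitudes
  by \<open>e\<^sup>i\<^sup>h\<close>; the reflection \<open>(u, v)(x) \<mapsto> (u(-x), -v(-x))\<close> becomes \<open>rflct\<close>, because
  \<open>\<beta>\<^sub>1\<^sub>,\<^sub>2\<close> is the complex conjugate of \<open>\<beta>\<^sub>1\<^sub>,\<^sub>1\<close>.\<close>

definition rot :: "real \<Rightarrow> complex \<times> complex \<Rightarrow> complex \<times> complex" where
  "rot h z = (cis h * fst z, cis h * snd z)"

definition rflct :: "complex \<times> complex \<Rightarrow> complex \<times> complex" where
  "rflct z = (- cnj (snd z), - cnj (fst z))"

text \<open>The conjuncts below: smoothness; mean-zero periodic profiles; \<open>z\<close> is the projection onto the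
  critical modes; the trivial solution lies on the manifold; tangency to the center subspace at
  criticality; \<open>O(2)\<close>-equivariance (translations, reflection); local invariance.  Smoothness is
  required jointly in \<open>(\<delta>, z, x)\<close>, which a \<open>C\<^sup>k\<close> map into a Sobolev space of high order provides.\<close>

definition center_manifold ::
    "real \<Rightarrow> real \<Rightarrow> real \<Rightarrow> real \<Rightarrow> nat \<Rightarrow> real \<Rightarrow> (real \<Rightarrow> complex \<times> complex \<Rightarrow> real \<Rightarrow> real) \<Rightarrow>
     (real \<Rightarrow> complex \<times> complex \<Rightarrow> real \<Rightarrow> real) \<Rightarrow> bool" where
  "center_manifold a c \<eta> \<delta>c k \<rho> U V \<longleftrightarrow>
     class_C k (ball \<delta>c \<rho> \<times> ball 0 \<rho> \<times> UNIV) (\<lambda>(\<delta>, z, x). (U \<delta> z x, V \<delta> z x)) \<and>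
     (\<forall>\<delta>\<in>ball \<delta>c \<rho>. \<forall>z\<in>ball 0 \<rho>. periodic_mean_zero (U \<delta> z) \<and> periodic_mean_zero (V \<delta> z)) \<and>
     (\<forall>\<delta>\<in>ball \<delta>c \<rho>. \<forall>z\<in>ball 0 \<rho>.
        vector [fourier_coeff (U \<delta> z) 1, fourier_coeff (V \<delta> z) 1] = critical_amplitude a c \<delta> z) \<and>
     (\<forall>\<delta>\<in>ball \<delta>c \<rho>. \<forall>x. U \<delta> 0 x = 0 \<and> V \<delta> 0 x = 0) \<and>
     (\<forall>x. ((\<lambda>z. U \<delta>c z x) has_derivative
              (\<lambda>z. 2 * Re (critical_amplitude a c \<delta>c z $ 1 * cis x))) (at 0) \<and>
          ((\<lambda>z. V \<delta>c z x) has_derivative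
              (\<lambda>z. 2 * Re (critical_amplitude a c \<delta>c z $ 2 * cis x))) (at 0)) \<and>
     (\<forall>\<delta>\<in>ball \<delta>c \<rho>. \<forall>z\<in>ball 0 \<rho>. \<forall>h x.
        U \<delta> (rot h z) x = U \<delta> z (x + h) \<and> V \<delta> (rot h z) x = V \<delta> z (x + h)) \<and>
     (\<forall>\<delta>\<in>ball \<delta>c \<rho>. \<forall>z\<in>ball 0 \<rho>. \<forall>x.
        U \<delta> (rflct z) x = U \<delta> z (- x) \<and> V \<delta> (rflct z) x = - V \<delta> z (- x)) \<and>
     (\<forall>\<delta>\<in>ball \<delta>c \<rho>. \<forall>z0\<in>ball 0 \<rho>. \<exists>\<epsilon>>0. \<exists>z. z 0 = z0 \<and>
        reduced_solution a c \<eta> \<rho> U V \<delta> {-\<epsilon><..<\<epsilon>} z)"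


section \<open>Normal form\<close>

definition cubic_field ::
    "complex \<Rightarrow> complex \<Rightarrow> complex \<Rightarrow> complex \<Rightarrow> complex \<times> complex \<Rightarrow> complex \<times> complex" where
  "cubic_field \<beta>1 \<beta>2 \<zeta> \<xi> = (\<lambda>(Z1, Z2).
     (\<beta>1 * Z1 + Z1 * (\<zeta> * of_real ((cmod Z1)\<^sup>2) + \<xi> * of_real ((cmod Z2)\<^sup>2)),
      \<beta>2 * Z2 + Z2 * (cnj \<xi> * of_real ((cmod Z1)\<^sup>2) + cnj \<zeta> * of_real ((cmod Z2)\<^sup>2))))"

text \<open>\<open>\<Theta> \<delta>\<close> is the near-identity change of coordinates \<open>(A, B) \<mapsto> (Z\<^sub>1, Z\<^sub>2)\<close>.\<close>

definition near_identity_equivariant ::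
    "real \<Rightarrow> nat \<Rightarrow> real \<Rightarrow> (real \<Rightarrow> complex \<times> complex \<Rightarrow> complex \<times> complex) \<Rightarrow> bool" where
  "near_identity_equivariant \<delta>c k \<rho> \<Theta> \<longleftrightarrow>
     class_C k (ball \<delta>c \<rho> \<times> ball 0 \<rho>) (\<lambda>(\<delta>, z). \<Theta> \<delta> z) \<and>
     (\<exists>K. \<forall>\<delta>\<in>ball \<delta>c \<rho>. \<forall>z\<in>ball 0 \<rho>. norm (\<Theta> \<delta> z - z) \<le> K * norm z ^ 3) \<and>
     (\<forall>\<delta>\<in>ball \<delta>c \<rho>. \<forall>z\<in>ball 0 \<rho>.
        (\<forall>h. \<Theta> \<delta> (rot h z) = rot h (\<Theta> \<delta> z)) \<and> \<Theta> \<delta> (rflct z) = rflct (\<Theta> \<delta> z))"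

definition brings_into_normal_form ::
    "real \<Rightarrow> real \<Rightarrow> real \<Rightarrow> real \<Rightarrow> real \<Rightarrow> (real \<Rightarrow> complex \<times> complex \<Rightarrow> real \<Rightarrow> real) \<Rightarrow>
     (real \<Rightarrow> complex \<times> complex \<Rightarrow> real \<Rightarrow> real) \<Rightarrow> (real \<Rightarrow> complex \<times> complex \<Rightarrow> complex \<times> complex) \<Rightarrow>
     complex \<Rightarrow> complex \<Rightarrow> bool" where
  "brings_into_normal_form a c \<eta> \<delta>c \<rho> U V \<Theta> \<zeta> \<xi> \<longleftrightarrow>
     (\<exists>K. \<forall>\<delta>\<in>ball \<delta>c \<rho>. \<forall>T z. open T \<and> reduced_solution a c \<eta> \<rho> U V \<delta> T z \<longrightarrow>
        (\<forall>t\<in>T. \<exists>R.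
           ((\<lambda>s. \<Theta> \<delta> (z s)) has_vector_derivative
              cubic_field (beta1 a c \<delta>) (beta2 a c \<delta>) \<zeta> \<xi> (\<Theta> \<delta> (z t)) + R) (at t) \<and>
           norm R \<le> K * (\<bar>\<delta> - \<delta>c\<bar> * norm (\<Theta> \<delta> (z t)) ^ 3 + norm (\<Theta> \<delta> (z t)) ^ 5)))"

text \<open>Center manifolds are of class \<open>C\<^sup>k\<close> for every finite \<open>k\<close> (on a neighbourhood depending on \<open>k\<close>);
  \<open>k = 5\<close> is what the order of the remainder calls for.\<close>

definition O2_Hopf_coefficients ::
    "real \<Rightarrow> real \<Rightarrow> real \<Rightarrow> real \<Rightarrow> complex \<Rightarrow> complex \<Rightarrow> bool" where
  "O2_Hopf_coefficients a c \<eta> \<delta>c \<zeta> \<xi> \<longleftrightarrow>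
     (\<exists>\<rho>>0. \<exists>U V \<Theta>. center_manifold a c \<eta> \<delta>c 5 \<rho> U V \<and>
        near_identity_equivariant \<delta>c 5 \<rho> \<Theta> \<and>
        brings_into_normal_form a c \<eta> \<delta>c \<rho> U V \<Theta> \<zeta> \<xi>)"


section \<open>Traveling and standing waves\<close>

definition truncated_solution ::
    "real \<Rightarrow> real \<Rightarrow> real \<Rightarrow> complex \<Rightarrow> complex \<Rightarrow> (real \<Rightarrow> complex \<times> complex) \<Rightarrow> bool" where
  "truncated_solution a c \<delta> \<zeta> \<xi> Z \<longleftrightarrow>
     (\<forall>t. (Z has_vector_derivative cubic_field (beta1 a c \<delta>) (beta2 a c \<delta>) \<zeta> \<xi> (Z t)) (at t))"

definition traveling_wave ::
    "real \<Rightarrow> real \<Rightarrow> real \<Rightarrow> complex \<Rightarrow> complex \<Rightarrow> real \<Rightarrow> real \<Rightarrow> bool" where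
  "traveling_wave a c \<delta> \<zeta> \<xi> r \<theta> \<longleftrightarrow>
     r > 0 \<and> r\<^sup>2 = - Re (beta1 a c \<delta>) / Re \<zeta> \<and>
     truncated_solution a c \<delta> \<zeta> \<xi> (\<lambda>t. (of_real r * cis (\<theta> * t), 0))"

definition standing_wave ::
    "real \<Rightarrow> real \<Rightarrow> real \<Rightarrow> complex \<Rightarrow> complex \<Rightarrow> real \<Rightarrow> real \<Rightarrow> bool" where
  "standing_wave a c \<delta> \<zeta> \<xi> r \<theta> \<longleftrightarrow>
     r > 0 \<and> r\<^sup>2 = - Re (beta1 a c \<delta>) / (Re \<zeta> + Re \<xi>) \<and>
     truncated_solution a c \<delta> \<zeta> \<xi> (\<lambda>t. (of_real r * cis (\<theta> * t), of_real r * cis (- (\<theta> * t))))"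

definition amplitude_field :: "real \<Rightarrow> complex \<Rightarrow> complex \<Rightarrow> real^2 \<Rightarrow> real^2" where
  "amplitude_field b \<zeta> \<xi> r = vector
     [b * r$1 + r$1 * (Re \<zeta> * (r$1)\<^sup>2 + Re \<xi> * (r$2)\<^sup>2),
      b * r$2 + r$2 * (Re \<xi> * (r$1)\<^sup>2 + Re \<zeta> * (r$2)\<^sup>2)]"

definition linearization_spectrum :: "(real^2 \<Rightarrow> real^2) \<Rightarrow> real^2 \<Rightarrow> complex set" where
  "linearization_spectrum G p =
     {\<mu>. eigenvalue (map_matrix of_real (matrix (frechet_derivative G (at p)))) \<mu>}"

text \<open>In the plane, eigenvalues on both sides of the imaginary axis already imply hyperbolicity.\<close>

definition saddle :: "(real^2 \<Rightarrow> real^2) \<Rightarrow> real^2 \<Rightarrow> bool" where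
  "saddle G p \<longleftrightarrow> G p = 0 \<and> G differentiable (at p) \<and>
     (\<exists>\<mu>\<in>linearization_spectrum G p. Re \<mu> < 0) \<and> (\<exists>\<mu>\<in>linearization_spectrum G p. Re \<mu> > 0)"

definition stable :: "(real^2 \<Rightarrow> real^2) \<Rightarrow> real^2 \<Rightarrow> bool" where
  "stable G p \<longleftrightarrow> G p = 0 \<and> G differentiable (at p) \<and>
     (\<forall>\<mu>\<in>linearization_spectrum G p. Re \<mu> < 0)"

text \<open>The waves inherit the type of the equilibrium \<open>(\<bar>Z\<^sub>1\<bar>, \<bar>Z\<^sub>2\<bar>)\<close> of the amplitude equations.\<close>

definition saddle_traveling_wave :: "real \<Rightarrow> real \<Rightarrow> real \<Rightarrow> complex \<Rightarrow> complex \<Rightarrow> real \<Rightarrow> bool" where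
  "saddle_traveling_wave a c \<delta> \<zeta> \<xi> r \<longleftrightarrow>
     saddle (amplitude_field (Re (beta1 a c \<delta>)) \<zeta> \<xi>) (vector [r, 0])"

definition stable_standing_wave :: "real \<Rightarrow> real \<Rightarrow> real \<Rightarrow> complex \<Rightarrow> complex \<Rightarrow> real \<Rightarrow> bool" where
  "stable_standing_wave a c \<delta> \<zeta> \<xi> r \<longleftrightarrow>
     stable (amplitude_field (Re (beta1 a c \<delta>)) \<zeta> \<xi>) (vector [r, r])"

end

theory Submission
  imports Defs
begin

text \<open>
The coefficients are determined at criticality alone, and by averaging.  Write \<open>z = (A, B)\<close>, and let
\<open>w z = \<kappa> A - cnj \<kappa> B\<close> with \<open>\<kappa> = i / (a + i\<omega>)\<close> be the first Fourier coefficient of the \<open>u\<close> component of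
the point of the center manifold over \<open>z\<close>.

The profile is \<open>2 Re (w e\<^sup>i\<^sup>x)\<close> plus a quadratic defect (\<open>profile_expansion\<close>).  Projecting the system onto
the first mode therefore expresses the reduced vector field, exactly, as its linear part
\<open>(i\<omega> A, -i\<omega> B)\<close> plus a multiple of one scalar nonlinearity (\<open>system_at_unique\<close>).  Up to fourth order
this nonlinearity is \<open>cnj w h + \<eta> w\<^sup>2 cnj w\<close>, where \<open>h\<close> is the second Fourier coefficient of \<open>u\<close>
(\<open>nonlinearity_1\<close>).

The cubic terms that survive in a normal form are those commuting with the linear flow, so both the
unknown coordinate change and the unknown second harmonic are averaged over the orbits of that flow.
Along such an orbit the contribution of the coordinate change is the derivative of a periodic
function and averages to zero (\<open>averaged_identity\<close>); hence the cubic normal form is the average of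
the cubic nonlinearity.  This average involves only the components of frequency \<open>0\<close> and \<open>2\<close> of \<open>h\<close>
along the orbit, and the projection of the system onto the second mode yields them from \<open>2 \<times> 2\<close> linear
systems with determinants \<open>\<Delta> 0\<close> and \<open>\<Delta> 2\<close> (\<open>second_mode_average\<close>).  The determinant \<open>\<Delta> 2\<close> is never
zero because its imaginary part is \<open>24 \<omega> (a + 1)\<close>, and \<open>\<Delta> 0 > 0\<close> by the hypothesis on \<open>c\<close>
(\<open>nonresonance_pos\<close>).  All errors are of fourth order, and a cubic form of fourth order is zero
(\<open>homogeneous_vanishes_eq_0\<close>), which gives the two coefficients (\<open>cubic_term_computed\<close>).

Since \<open>Re \<xi> = 0\<close> and \<open>Re \<zeta> < 0\<close>, the amplitude equations decouple into two identical supercritical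
pitchforks, from which the types of the waves are read off.
\<close>

section \<open>Fourier coefficients on the circle\<close>

text \<open>One notion of Fourier coefficient serves two circles: the space variable \<open>x\<close>, and the phase \<open>s\<close> of
the linear flow, along which the normal form is extracted by averaging.\<close>

definition fc :: "(real \<Rightarrow> complex) \<Rightarrow> int \<Rightarrow> complex" where
  "fc f m = integral {0..2 * pi} (\<lambda>x. f x * cis (- (of_int m * x))) / of_real (2 * pi)"

lemma fourier_coeff_eq_fc: "fourier_coeff u m = fc (\<lambda>x. of_real (u x)) m"
  by (simp add: fourier_coeff_def fc_def)

lemma fc_integrable:
  "continuous_on {0..2 * pi} f \<Longrightarrow> (\<lambda>x. f x * cis (- (of_int m * x))) integrable_on {0..2 * pi}"
  by (intro integrable_continuous_real continuous_intros)

lemma fc_add: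
  assumes "continuous_on {0..2 * pi} f" "continuous_on {0..2 * pi} g"
  shows "fc (\<lambda>x. f x + g x) m = fc f m + fc g m"
  unfolding fc_def
  by (simp add: distrib_right integral_add[OF fc_integrable fc_integrable] assms add_divide_distrib)

lemma fc_cmult: "fc (\<lambda>x. k * f x) m = k * fc f m"
  unfolding fc_def by (simp add: mult.assoc)

lemma fc_divide: "fc (\<lambda>x. f x / k) m = fc f m / k"
  using fc_cmult[of "inverse k" f m] by (simp add: field_simps)

lemma fc_diff:
  assumes "continuous_on {0..2 * pi} f" "continuous_on {0..2 * pi} g"
  shows "fc (\<lambda>x. f x - g x) m = fc f m - fc g m"
  using fc_add[of f "\<lambda>x. -1 * g x" m] fc_cmult[of "-1" g m] assms
  by (simp add: continuous_on_minus)

lemma fc_cis_mult: "fc (\<lambda>x. cis (of_int k * x) * f x) m = fc f (m - k)"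
proof -
  have "cis (of_int k * x) * f x * cis (- (of_int m * x)) = f x * cis (- (of_int (m - k) * x))" for x
  proof -
    have "cis (of_int k * x) * f x * cis (- (of_int m * x))
          = f x * (cis (of_int k * x) * cis (- (of_int m * x)))" by simp
    also have "\<dots> = f x * cis (- (of_int (m - k) * x))" by (simp add: cis_mult algebra_simps)
    finally show ?thesis .
  qed
  then have "(\<lambda>x. cis (of_int k * x) * f x * cis (- (of_int m * x)))
      = (\<lambda>x. f x * cis (- (of_int (m - k) * x)))" by blast
  then show ?thesis unfolding fc_def by (simp only:)
qed

lemma fc_bound:
  assumes "continuous_on {0..2 * pi} f" and "\<And>x. x \<in> {0..2 * pi} \<Longrightarrow> norm (f x) \<le> B"
  shows "norm (fc f m) \<le> B"
proof -
  have "norm (integral {0..2 * pi} (\<lambda>x. f x * cis (- (of_int m * x)))) \<le> B * (2 * pi - 0)"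
    by (rule integral_bound) (use assms in \<open>auto intro!: continuous_intros simp: norm_mult\<close>)
  then show ?thesis by (simp add: fc_def norm_divide field_simps)
qed

text \<open>Integration by parts on the circle; the gauge integral integrates every derivative.\<close>

lemma fc_derivative:
  assumes f: "\<And>x. x \<in> {0..2 * pi} \<Longrightarrow> (f has_vector_derivative f' x) (at x within {0..2 * pi})"
    and per: "f (2 * pi) = f 0"
  shows "fc f' m = \<i> * of_int m * fc f m"
proof -
  let ?e = "\<lambda>x. cis (- (of_int m * x))"
  have cont: "continuous_on {0..2 * pi} f"
    using f by (rule continuous_on_vector_derivative)
  have e: "(?e has_vector_derivative - (\<i> * of_int m) * ?e x) (at x within {0..2 * pi})" for x
    unfolding cis_conv_exp
    by (auto intro!: derivative_eq_intros has_vector_derivative_real_field simp: algebra_simps)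
  have "((\<lambda>x. f x * (- (\<i> * of_int m) * ?e x) + f' x * ?e x) has_integral
          f (2 * pi) * ?e (2 * pi) - f 0 * ?e 0) {0..2 * pi}"
    by (rule fundamental_theorem_of_calculus)
      (use has_vector_derivative_mult[OF f e] in auto)
  moreover have "?e (2 * pi) = 1"
    using cis_multiple_2pi[of "- of_int m"] by (simp add: mult.commute)
  ultimately have "((\<lambda>x. f x * (- (\<i> * of_int m) * ?e x) + f' x * ?e x) has_integral 0) {0..2 * pi}"
    by (simp add: per)
  moreover have "((\<lambda>x. \<i> * of_int m * (f x * ?e x)) has_integral
      \<i> * of_int m * integral {0..2 * pi} (\<lambda>x. f x * ?e x)) {0..2 * pi}"
    using fc_integrable[OF cont, of m] by (intro has_integral_mult_right integrable_integral)
  ultimately have "((\<lambda>x. f x * (- (\<i> * of_int m) * ?e x) + f' x * ?e x + \<i> * of_int m * (f x * ?e x))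
      has_integral 0 + \<i> * of_int m * integral {0..2 * pi} (\<lambda>x. f x * ?e x)) {0..2 * pi}"
    by (rule has_integral_add)
  then have "((\<lambda>x. f' x * ?e x) has_integral
      \<i> * of_int m * integral {0..2 * pi} (\<lambda>x. f x * ?e x)) {0..2 * pi}"
    by (simp add: algebra_simps)
  then show ?thesis by (simp add: fc_def integral_unique)
qed

lemma fc_const: "fc (\<lambda>x. k) m = (if m = 0 then k else 0)"
proof (cases "m = 0")
  case True then show ?thesis by (simp add: fc_def scaleR_conv_of_real)
next
  case False
  have "fc (\<lambda>x. 0) m = \<i> * of_int m * fc (\<lambda>x. k) m"
    by (rule fc_derivative) auto
  then show ?thesis using False by (simp add: fc_def[of "\<lambda>x. 0"])
qed

lemma fc_monomial: "fc (\<lambda>x. k * cis (of_int n * x)) m = (if m = n then k else 0)"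
  using fc_cis_mult[of n "\<lambda>x. k" m] by (simp add: fc_const mult.commute)

text \<open>A list of coefficients and frequencies turns every extraction of a resonant monomial below into
  a computation by the simplifier.\<close>

lemma fc_trig_poly:
  "fc (\<lambda>x. \<Sum>(k, n)\<leftarrow>ps. k * cis (of_int n * x)) m = (\<Sum>(k, n)\<leftarrow>ps. if m = n then k else 0)"
proof (induction ps)
  case Nil then show ?case by (simp add: fc_def)
next
  case (Cons p ps)
  obtain k n where p: "p = (k, n)" by force
  have "continuous_on {0..2 * pi} (\<lambda>x. \<Sum>(k, n)\<leftarrow>ps. k * cis (of_int n * x))"
    by (induction ps) (auto intro!: continuous_intros split: prod.splits)
  then have "fc (\<lambda>x. k * cis (of_int n * x) + (\<Sum>(k, n)\<leftarrow>ps. k * cis (of_int n * x))) m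
     = fc (\<lambda>x. k * cis (of_int n * x)) m + fc (\<lambda>x. \<Sum>(k, n)\<leftarrow>ps. k * cis (of_int n * x)) m"
    by (intro fc_add continuous_intros)
  then show ?case by (simp add: p Cons fc_monomial)
qed

lemma class_C_deriv:
  fixes u :: "real \<Rightarrow> real"
  assumes "class_C (Suc k) UNIV u"
  shows "class_C k UNIV (deriv u)" "(u has_real_derivative deriv u x) (at x)"
proof -
  have d: "u differentiable (at x)" for x using assms by simp
  then show *: "(u has_real_derivative deriv u x) (at x)" for x
    using DERIV_deriv_iff_real_differentiable by blast
  have "frechet_derivative u (at x) 1 = deriv u x" for x
    using frechet_derivative_at[OF *[of x, unfolded has_field_derivative_def]] by (metis mult.right_neutral)
  then have "(\<lambda>x. frechet_derivative u (at x) 1) = deriv u" by blast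
  moreover have "class_C k UNIV (\<lambda>x. frechet_derivative u (at x) 1)" using assms by simp
  ultimately show "class_C k UNIV (deriv u)" by (simp only:)
qed

lemma fc_iterated_deriv:
  fixes u :: "real \<Rightarrow> real"
  assumes "class_C n UNIV u" and "\<And>x. u (x + 2 * pi) = u x"
  shows "fc (\<lambda>x. of_real ((deriv ^^ n) u x)) m = (\<i> * of_int m) ^ n * fc (\<lambda>x. of_real (u x)) m"
    and "continuous_on UNIV ((deriv ^^ n) u)"
proof -
  have "fc (\<lambda>x. of_real ((deriv ^^ n) u x)) m = (\<i> * of_int m) ^ n * fc (\<lambda>x. of_real (u x)) m
      \<and> continuous_on UNIV ((deriv ^^ n) u)"
    using assms
  proof (induction n arbitrary: u)
    case 0 then show ?case by simp
  next
    case (Suc n)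
    note d = class_C_deriv[OF Suc.prems(1)]
    have "deriv u (x + 2 * pi) = deriv u x" for x
    proof -
      have "((\<lambda>y. u (y + 2 * pi)) has_real_derivative deriv u (x + 2 * pi)) (at x)"
        using d(2)[of "x + 2 * pi"] by (simp add: DERIV_shift)
      then have "(u has_real_derivative deriv u (x + 2 * pi)) (at x)"
        using Suc.prems(2) by simp
      then show ?thesis by (simp add: DERIV_imp_deriv)
    qed
    then have IH: "fc (\<lambda>x. of_real ((deriv ^^ n) (deriv u) x)) m
        = (\<i> * of_int m) ^ n * fc (\<lambda>x. of_real (deriv u x)) m"
      "continuous_on UNIV ((deriv ^^ n) (deriv u))"
      using Suc.IH d(1) by blast+
    have "fc (\<lambda>x. of_real (deriv u x)) m = \<i> * of_int m * fc (\<lambda>x. of_real (u x)) m"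
    proof (rule fc_derivative)
      show "((\<lambda>x. complex_of_real (u x)) has_vector_derivative of_real (deriv u x)) (at x within {0..2 * pi})" for x
        using d(2)[of x] by (intro has_vector_derivative_of_real)
          (simp add: has_real_derivative_iff_has_vector_derivative has_vector_derivative_at_within)
      show "complex_of_real (u (2 * pi)) = of_real (u 0)" using Suc.prems(2)[of 0] by simp
    qed
    with IH show ?case by (simp add: funpow_swap1)
  qed
  then show "fc (\<lambda>x. of_real ((deriv ^^ n) u x)) m = (\<i> * of_int m) ^ n * fc (\<lambda>x. of_real (u x)) m"
    and "continuous_on UNIV ((deriv ^^ n) u)" by auto
qed

lemma cis_square_identity:
  "(p * cis x + q * cis (- x))\<^sup>2 =
     (\<Sum>(k, n)\<leftarrow>[(p\<^sup>2, 2), (2 * p * q, 0), (q\<^sup>2, -2)]. k * cis (of_int n * x))"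
proof -
  have "cis x * cis (- x) = 1" "cis (2 * x) = cis x * cis x" "cis (- (2 * x)) = cis (- x) * cis (- x)"
    by (simp_all add: cis_mult)
  then show ?thesis by simp algebra
qed

lemma cis_cube_identity:
  "(p * cis x + q * cis (- x))\<^sup>2 * (r * cis x + s * cis (- x)) =
     (\<Sum>(k, n)\<leftarrow>[(p\<^sup>2 * r, 3), (p\<^sup>2 * s + 2 * p * q * r, 1), (2 * p * q * s + q\<^sup>2 * r, -1), (q\<^sup>2 * s, -3)].
        k * cis (of_int n * x))"
proof -
  have "cis x * cis (- x) = 1" "cis (3 * x) = cis x * cis x * cis x"
    "cis (- (3 * x)) = cis (- x) * cis (- x) * cis (- x)"
    by (simp_all add: cis_mult)
  then show ?thesis by simp algebra
qed

section \<open>Maps with continuous derivatives\<close>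

lemma norm_fst_snd_le:
  fixes p :: "'a::real_normed_vector \<times> 'b::real_normed_vector"
  shows "norm (fst p) \<le> norm p" "norm (snd p) \<le> norm p"
  using norm_fst_le[of "fst p" "snd p"] norm_snd_le[of "snd p" "fst p"] by simp_all

lemma class_C_differentiable:
  "class_C (Suc k) S f \<Longrightarrow> x \<in> S \<Longrightarrow> (f has_derivative frechet_derivative f (at x)) (at x)"
  using frechet_derivative_works by auto

lemma class_C_Suc_imp: "class_C (Suc k) S f \<Longrightarrow> class_C k S f"
proof (induction k arbitrary: f)
  case 0
  then show ?case
    by (auto intro!: continuous_at_imp_continuous_on differentiable_imp_continuous_within)
next
  case (Suc k)
  then show ?case by (metis class_C.simps(2))
qed

lemma class_C_mono: "class_C k S f \<Longrightarrow> j \<le> k \<Longrightarrow> class_C j S f"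
proof (induction k)
  case (Suc k) then show ?case using class_C_Suc_imp le_Suc_eq by metis
qed simp

lemma class_C_continuous_derivative:
  fixes f :: "'a::euclidean_space \<Rightarrow> 'b::real_normed_vector"
  assumes "class_C (Suc 0) S f"
  shows "continuous_on (S \<times> UNIV) (\<lambda>(x, v). frechet_derivative f (at x) v)"
proof -
  have "frechet_derivative f (at x) v = (\<Sum>b\<in>Basis. (v \<bullet> b) *\<^sub>R frechet_derivative f (at x) b)"
    if "x \<in> S" for x v
  proof -
    have "linear (frechet_derivative f (at x))"
      using assms that by (simp add: linear_frechet_derivative)
    then show ?thesis
      by (subst euclidean_representation[of v, symmetric])
        (simp add: linear_sum linear_cmul del: euclidean_representation)
  qed
  moreover have "continuous_on (S \<times> UNIV) (\<lambda>p. \<Sum>b\<in>Basis. (snd p \<bullet> b) *\<^sub>R frechet_derivative f (at (fst p)) b)"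
    using assms by (intro continuous_intros) (auto intro!: continuous_on_compose2[of S _ _ fst] continuous_intros)
  ultimately show ?thesis
    by (auto intro: continuous_on_eq)
qed

text \<open>Each directional derivative is differentiable at \<open>x0\<close>, hence Lipschitz there; linearity in the
direction reduces the claim to the finitely many basis vectors.\<close>

lemma class_C_derivative_estimate:
  fixes f :: "'a::euclidean_space \<Rightarrow> 'b::real_normed_vector"
  assumes f: "class_C 2 S f" and S: "open S" "x0 \<in> S"
  shows "\<exists>K. \<exists>r>0. ball x0 r \<subseteq> S \<and> (\<forall>x\<in>ball x0 r. \<forall>v.
     norm (frechet_derivative f (at x) v - frechet_derivative f (at x0) v) \<le> K * norm (x - x0) * norm v)"
proof -
  let ?D = "\<lambda>x. frechet_derivative f (at x)"
  have "\<exists>K. \<exists>r>0. \<forall>x\<in>ball x0 r. norm (?D x b - ?D x0 b) \<le> K * norm (x - x0)" for b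
  proof -
    have "(\<lambda>x. ?D x b) differentiable (at x0)" using f S by (simp add: numeral_2_eq_2)
    then obtain L where L: "((\<lambda>x. ?D x b) has_derivative L) (at x0)"
      by (auto simp: differentiable_def)
    then have "bounded_linear L" by (rule has_derivative_bounded_linear)
    then obtain B where B: "\<And>v. norm (L v) \<le> norm v * B" using bounded_linear.bounded by blast
    obtain d where d: "d > 0" "\<And>y. norm (y - x0) < d \<Longrightarrow>
        norm (?D y b - ?D x0 b - L (y - x0)) \<le> 1 * norm (y - x0)"
      using L unfolding has_derivative_at_alt by (meson zero_less_one)
    have "norm (?D x b - ?D x0 b) \<le> (1 + B) * norm (x - x0)" if "x \<in> ball x0 d" for x
    proof -
      have "norm (?D x b - ?D x0 b) \<le> norm (?D x b - ?D x0 b - L (x - x0)) + norm (L (x - x0))"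
        by (metis norm_triangle_sub add.commute)
      also have "\<dots> \<le> 1 * norm (x - x0) + norm (x - x0) * B"
        using d(2)[of x] B[of "x - x0"] that by (intro add_mono) (auto simp: dist_norm norm_minus_commute)
      finally show ?thesis by (simp add: algebra_simps)
    qed
    with d(1) show ?thesis by blast
  qed
  then obtain K r where Kr: "\<And>b. r b > 0"
      "\<And>b x. x \<in> ball x0 (r b) \<Longrightarrow> norm (?D x b - ?D x0 b) \<le> K b * norm (x - x0)"
    by metis
  obtain e where e: "e > 0" "ball x0 e \<subseteq> S" using S openE by blast
  define R where "R = Min (insert e (r ` Basis))"
  have R: "R > 0" "R \<le> e" "\<And>b. b \<in> Basis \<Longrightarrow> R \<le> r b"
    using Kr(1) e unfolding R_def by (auto intro: min.coboundedI2 Min_le)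
  have "norm (?D x v - ?D x0 v) \<le> (\<Sum>b\<in>Basis. K b) * norm (x - x0) * norm v" if x: "x \<in> ball x0 R" for x v
  proof -
    have xS: "x \<in> S" using x R e by auto
    have lin: "linear (\<lambda>v. ?D x v - ?D x0 v)"
      using f S xS by (auto intro!: linear_compose_sub linear_frechet_derivative simp: numeral_2_eq_2)
    have "?D x v - ?D x0 v = (\<Sum>b\<in>Basis. (v \<bullet> b) *\<^sub>R (?D x b - ?D x0 b))"
      using linear_sum[OF lin, of "\<lambda>b. (v \<bullet> b) *\<^sub>R b" Basis] linear_cmul[OF lin]
      by (simp add: euclidean_representation)
    also have "norm \<dots> \<le> (\<Sum>b\<in>Basis. norm v * (K b * norm (x - x0)))"
    proof (rule order_trans[OF norm_sum], rule sum_mono)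
      fix b :: 'a assume b: "b \<in> Basis"
      have "norm ((v \<bullet> b) *\<^sub>R (?D x b - ?D x0 b)) = \<bar>v \<bullet> b\<bar> * norm (?D x b - ?D x0 b)" by simp
      also have "\<dots> \<le> norm v * (K b * norm (x - x0))"
        using x R(3)[OF b] by (intro mult_mono Basis_le_norm[OF b] Kr(2)) auto
      finally show "norm ((v \<bullet> b) *\<^sub>R (?D x b - ?D x0 b)) \<le> norm v * (K b * norm (x - x0))" .
    qed
    also have "\<dots> = (\<Sum>b\<in>Basis. K b) * norm (x - x0) * norm v"
      by (simp add: sum_distrib_left sum_distrib_right mult_ac)
    finally show ?thesis .
  qed
  moreover have "ball x0 R \<subseteq> S" using R e by auto
  ultimately show ?thesis using R by blast
qed

lemma class_C_taylor:
  fixes f :: "'a::euclidean_space \<Rightarrow> 'b::real_normed_vector"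
  assumes f: "class_C 2 S f" and S: "open S" "x0 \<in> S"
  shows "\<exists>K. \<exists>r>0. \<forall>x\<in>ball x0 r.
     norm (f x - f x0 - frechet_derivative f (at x0) (x - x0)) \<le> K * (norm (x - x0))\<^sup>2"
proof -
  let ?D = "\<lambda>x. frechet_derivative f (at x)"
  obtain K r where r: "r > 0" "ball x0 r \<subseteq> S" and
    K: "\<And>x v. x \<in> ball x0 r \<Longrightarrow> norm (?D x v - ?D x0 v) \<le> K * norm (x - x0) * norm v"
    using class_C_derivative_estimate[OF assms] by blast
  have "norm (f x - f x0 - ?D x0 (x - x0)) \<le> norm (x - x0) * (\<bar>K\<bar> * norm (x - x0))"
    if x: "x \<in> ball x0 r" for x
  proof (rule differentiable_bound_linearization[where S = "cball x0 (norm (x - x0))" and f' = ?D])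
    have sub: "cball x0 (norm (x - x0)) \<subseteq> ball x0 r" using x by (auto simp: dist_norm norm_minus_commute)
    show "x0 + t *\<^sub>R (x - x0) \<in> cball x0 (norm (x - x0))" if "t \<in> {0..1}" for t
      using that by (auto simp: dist_norm mult_left_le_one_le)
    show "x0 \<in> cball x0 (norm (x - x0))" by simp
    fix y assume y: "y \<in> cball x0 (norm (x - x0))"
    then have yS: "y \<in> S" using sub r by auto
    show "(f has_derivative ?D y) (at y within cball x0 (norm (x - x0)))"
      using f yS has_derivative_at_withinI class_C_differentiable[of 1 S f y]
      by (simp add: numeral_2_eq_2)
    have "norm (?D y v - ?D x0 v) \<le> \<bar>K\<bar> * norm (x - x0) * norm v" for v
    proof -
      have "norm (?D y v - ?D x0 v) \<le> K * norm (y - x0) * norm v" using K y sub by auto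
      also have "\<dots> \<le> \<bar>K\<bar> * norm (x - x0) * norm v"
        using y by (intro mult_mono) (auto simp: dist_norm norm_minus_commute)
      finally show ?thesis .
    qed
    then show "onorm (?D y - ?D x0) \<le> \<bar>K\<bar> * norm (x - x0)"
      by (intro onorm_bound) auto
  qed
  then show ?thesis using r by (intro exI[of _ "\<bar>K\<bar>"] exI[of _ r]) (auto simp: power2_eq_square mult_ac)
qed

section \<open>Orders of vanishing, uniformly in a parameter\<close>

type_synonym amplitudes = "complex \<times> complex"

text \<open>The second argument is a parameter (the position \<open>x\<close> or the phase
\<open>s\<close>) in which the bound is uniform, so that the order survives integration over the circle.\<close>

definition vanishes :: "nat \<Rightarrow> (amplitudes \<Rightarrow> real \<Rightarrow> complex) \<Rightarrow> bool" where
  "vanishes k f \<longleftrightarrow> (\<exists>K. \<exists>r>0. \<forall>z x. norm z < r \<longrightarrow> norm (f z x) \<le> K * norm z ^ k)"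

lemma vanishesI:
  assumes "r > 0" "\<And>z x. norm z < r \<Longrightarrow> norm (f z x) \<le> K * norm z ^ k"
  shows "vanishes k f"
  using assms unfolding vanishes_def by blast

lemma vanishesE:
  assumes "vanishes k f"
  obtains K r where "K \<ge> 0" "r > 0" "r \<le> 1" "\<And>z x. norm z < r \<Longrightarrow> norm (f z x) \<le> K * norm z ^ k"
proof -
  obtain K r where *: "r > 0" "\<And>z x. norm z < r \<Longrightarrow> norm (f z x) \<le> K * norm z ^ k"
    using assms unfolding vanishes_def by blast
  have "norm (f z x) \<le> \<bar>K\<bar> * norm z ^ k" if "norm z < min r 1" for z x
    using *(2)[of z x] that by (rule_tac order_trans) (auto intro: mult_right_mono)
  then show thesis using that[of "\<bar>K\<bar>" "min r 1"] * by auto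
qed

lemma vanishes_dominated:
  assumes "vanishes k g" "r > 0" "\<And>z x. norm z < r \<Longrightarrow> norm (f z x) \<le> C * norm (g z x)"
  shows "vanishes k f"
proof -
  obtain K s where *: "K \<ge> 0" "s > 0" "\<And>z x. norm z < s \<Longrightarrow> norm (g z x) \<le> K * norm z ^ k"
    using vanishesE[OF assms(1)] by metis
  have "norm (f z x) \<le> \<bar>C\<bar> * K * norm z ^ k" if z: "norm z < min r s" for z x
  proof -
    have "norm (f z x) \<le> C * norm (g z x)" using assms(3) z by simp
    also have "\<dots> \<le> \<bar>C\<bar> * (K * norm z ^ k)"
      using *(3)[of z x] z by (intro mult_mono) auto
    finally show ?thesis by simp
  qed
  then show ?thesis using \<open>r > 0\<close> \<open>s > 0\<close> by (intro vanishesI[of "min r s"]) auto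
qed

lemma vanishes_cong:
  assumes "r > 0" "\<And>z x. norm z < r \<Longrightarrow> f z x = g z x" "vanishes k g"
  shows "vanishes k f"
  by (rule vanishes_dominated[OF assms(3,1), of f 1]) (simp add: assms(2))

lemma vanishes_add:
  assumes "vanishes k f" "vanishes k g"
  shows "vanishes k (\<lambda>z x. f z x + g z x)"
proof -
  obtain K r where 1: "r > 0" "\<And>z x. norm z < r \<Longrightarrow> norm (f z x) \<le> K * norm z ^ k"
    using vanishesE[OF assms(1)] by metis
  obtain L s where 2: "s > 0" "\<And>z x. norm z < s \<Longrightarrow> norm (g z x) \<le> L * norm z ^ k"
    using vanishesE[OF assms(2)] by metis
  show ?thesis
  proof (rule vanishesI[of "min r s"])
    fix z :: amplitudes and x :: real assume "norm z < min r s"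
    then show "norm (f z x + g z x) \<le> (K + L) * norm z ^ k"
      using 1(2)[of z x] 2(2)[of z x] norm_triangle_ineq[of "f z x" "g z x"] by (simp add: algebra_simps)
  qed (use 1 2 in auto)
qed

lemma vanishes_mult:
  assumes "vanishes j f" "vanishes k g"
  shows "vanishes (j + k) (\<lambda>z x. f z x * g z x)"
proof -
  obtain K r where 1: "K \<ge> 0" "r > 0" "\<And>z x. norm z < r \<Longrightarrow> norm (f z x) \<le> K * norm z ^ j"
    using vanishesE[OF assms(1)] by metis
  obtain L s where 2: "L \<ge> 0" "s > 0" "\<And>z x. norm z < s \<Longrightarrow> norm (g z x) \<le> L * norm z ^ k"
    using vanishesE[OF assms(2)] by metis
  show ?thesis
  proof (rule vanishesI[of "min r s"])
    fix z :: amplitudes and x :: real assume "norm z < min r s"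
    then have "norm (f z x) * norm (g z x) \<le> (K * norm z ^ j) * (L * norm z ^ k)"
      using 1 2 by (intro mult_mono) auto
    then show "norm (f z x * g z x) \<le> (K * L) * norm z ^ (j + k)"
      by (simp add: norm_mult power_add mult_ac)
  qed (use 1 2 in auto)
qed

lemma vanishes_mono:
  assumes "vanishes k f" "j \<le> k"
  shows "vanishes j f"
proof -
  obtain K r where 1: "K \<ge> 0" "r > 0" "r \<le> 1" "\<And>z x. norm z < r \<Longrightarrow> norm (f z x) \<le> K * norm z ^ k"
    using vanishesE[OF assms(1)] by metis
  show ?thesis
  proof (rule vanishesI[of r])
    fix z :: amplitudes and x :: real assume z: "norm z < r"
    have "norm (f z x) \<le> K * norm z ^ k" using 1 z by simp
    also have "\<dots> \<le> K * norm z ^ j"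
      using 1 z assms(2) by (intro mult_left_mono power_decreasing) auto
    finally show "norm (f z x) \<le> K * norm z ^ j" .
  qed (use 1 in auto)
qed

lemma vanishes_const: "vanishes 0 (\<lambda>z x. k)"
  by (rule vanishesI[of 1 _ "norm k"]) auto

lemma vanishes_bounded: "(\<And>z x. norm (f z x) \<le> K) \<Longrightarrow> vanishes 0 f"
  by (rule vanishesI[of 1 _ K]) auto

lemma vanishes_cmult: "vanishes k f \<Longrightarrow> vanishes k (\<lambda>z x. c * f z x)"
  using vanishes_mult[OF vanishes_const, of k f c] by simp

lemma vanishes_diff: "vanishes k f \<Longrightarrow> vanishes k g \<Longrightarrow> vanishes k (\<lambda>z x. f z x - g z x)"
  using vanishes_add[of k f "\<lambda>z x. -1 * g z x"] vanishes_cmult[of k g "-1"] by simp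

lemma vanishes_uminus: "vanishes k f \<Longrightarrow> vanishes k (\<lambda>z x. - f z x)"
  using vanishes_cmult[of k f "-1"] by simp

lemma vanishes_cnj: "vanishes k f \<Longrightarrow> vanishes k (\<lambda>z x. cnj (f z x))"
  unfolding vanishes_def by simp

lemma vanishes_fst: "vanishes 1 (\<lambda>z x. fst z)"
  by (rule vanishesI[of 1 _ 1]) (auto intro: norm_fst_le)

lemma vanishes_snd: "vanishes 1 (\<lambda>z x. snd z)"
  by (rule vanishesI[of 1 _ 1]) (auto intro: norm_snd_le)

lemma vanishes_norm: "vanishes 1 (\<lambda>z x. of_real (norm z))"
  by (rule vanishesI[of 1 _ 1]) auto

lemma vanishes_fc:
  assumes "vanishes k f" "\<rho> > 0" "\<And>z. norm z < \<rho> \<Longrightarrow> continuous_on {0..2 * pi} (f z)"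
  shows "vanishes k (\<lambda>z x. fc (f z) m)"
proof -
  obtain K r where 1: "r > 0" "\<And>z x. norm z < r \<Longrightarrow> norm (f z x) \<le> K * norm z ^ k"
    using vanishesE[OF assms(1)] by metis
  show ?thesis
    by (rule vanishesI[of "min r \<rho>" _ K]) (use 1 assms in \<open>auto intro!: fc_bound\<close>)
qed

lemma vanishes_isometry:
  assumes "vanishes k f" "\<And>x z. norm (g x z) = norm z"
  shows "vanishes k (\<lambda>z x. f (g x z) (y x))"
  using assms unfolding vanishes_def by metis

lemma vanishes_triple_product_diff:
  assumes "vanishes 1 f1" "vanishes 1 f2" "vanishes 1 f3" "vanishes 1 g1" "vanishes 1 g2" "vanishes 1 g3"
    "vanishes 3 (\<lambda>z x. f1 z x - g1 z x)" "vanishes 3 (\<lambda>z x. f2 z x - g2 z x)" "vanishes 3 (\<lambda>z x. f3 z x - g3 z x)"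
  shows "vanishes 5 (\<lambda>z x. f1 z x * f2 z x * f3 z x - g1 z x * g2 z x * g3 z x)"
proof -
  have "vanishes (3 + 1 + 1) (\<lambda>z x. (f1 z x - g1 z x) * f2 z x * f3 z x)"
    by (intro vanishes_mult assms)
  moreover have "vanishes (1 + 3 + 1) (\<lambda>z x. g1 z x * (f2 z x - g2 z x) * f3 z x)"
    by (intro vanishes_mult assms)
  moreover have "vanishes (1 + 1 + 3) (\<lambda>z x. g1 z x * g2 z x * (f3 z x - g3 z x))"
    by (intro vanishes_mult assms)
  ultimately have "vanishes 5 (\<lambda>z x. (f1 z x - g1 z x) * f2 z x * f3 z x
      + (g1 z x * (f2 z x - g2 z x) * f3 z x + g1 z x * g2 z x * (f3 z x - g3 z x)))"
    by (intro vanishes_add) simp_all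
  then show ?thesis by (simp add: algebra_simps)
qed

text \<open>This is what turns an identity up to higher order into an exact identity between the coefficients
of the leading monomials.\<close>

lemma homogeneous_vanishes_eq_0:
  assumes "vanishes (Suc k) (\<lambda>z x. P z)"
    and hom: "\<And>t z. P (t *\<^sub>R z) = of_real t ^ k * P z"
  shows "P z = 0"
proof (rule ccontr)
  assume nz: "P z \<noteq> 0"
  obtain K r where 1: "K \<ge> 0" "r > 0" "\<And>z x. norm z < r \<Longrightarrow> norm (P z) \<le> K * norm z ^ Suc k"
    using vanishesE[OF assms(1)] by metis
  define L where "L = K * norm z ^ Suc k"
  have L: "L \<ge> 0" using 1 by (simp add: L_def)
  \<comment> \<open>Scaled by this \<open>t\<close>, the point is in the ball, and the bound of order \<open>k + 1\<close> is at most half of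
    the value that homogeneity dictates.\<close>
  define t where "t = min (r / (2 * (norm z + 1))) (norm (P z) / (2 * (L + 1)))"
  have t: "t > 0" using 1 nz L unfolding t_def by (auto simp: add_nonneg_pos)
  have "t * norm z \<le> r / (2 * (norm z + 1)) * (norm z + 1)"
    using t by (intro mult_mono) (auto simp: t_def)
  also have "\<dots> = r / 2" by (simp add: field_simps add_nonneg_eq_0_iff)
  also have "\<dots> < r" using 1 by simp
  finally have "norm (t *\<^sub>R z) < r" using t by simp
  then have "norm (P (t *\<^sub>R z)) \<le> K * norm (t *\<^sub>R z) ^ Suc k" using 1(3) by blast
  then have "t ^ k * norm (P z) \<le> t ^ k * (t * L)"
    using t by (simp add: hom norm_mult norm_power L_def power_mult_distrib mult_ac)
  then have "norm (P z) \<le> t * L" using t by simp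
  also have "\<dots> \<le> norm (P z) / (2 * (L + 1)) * (L + 1)"
    using t L by (intro mult_mono) (auto simp: t_def)
  also have "\<dots> = norm (P z) / 2" using L by (simp add: field_simps)
  finally show False using nz by simp
qed


section \<open>Families of profiles\<close>

text \<open>The regularity of the profiles that the argument uses: differentiability in the amplitudes, with a
derivative jointly continuous in base point, position and direction.\<close>

definition smooth_family ::
    "real \<Rightarrow> (amplitudes \<Rightarrow> real \<Rightarrow> real) \<Rightarrow> (amplitudes \<Rightarrow> real \<Rightarrow> amplitudes \<Rightarrow> real) \<Rightarrow> bool" where
  "smooth_family \<rho> u Du \<longleftrightarrow>
     (\<forall>z\<in>ball 0 \<rho>. \<forall>x. ((\<lambda>z. u z x) has_derivative Du z x) (at z)) \<and>
     continuous_on (ball 0 \<rho> \<times> UNIV \<times> UNIV) (\<lambda>(z, x, v). Du z x v) \<and>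
     (\<forall>z\<in>ball 0 \<rho>. continuous_on UNIV (u z))"

lemma smooth_family_continuous_Du:
  assumes "smooth_family \<rho> u Du" "continuous_on S f" "continuous_on S g" "continuous_on S h"
    "\<And>p. p \<in> S \<Longrightarrow> f p \<in> ball 0 \<rho>"
  shows "continuous_on S (\<lambda>p. Du (f p) (g p) (h p))"
proof -
  have "continuous_on S ((\<lambda>(z, x, v). Du z x v) \<circ> (\<lambda>p. (f p, g p, h p)))"
    using assms by (intro continuous_on_compose continuous_intros)
      (auto simp: smooth_family_def elim!: continuous_on_subset)
  then show ?thesis by (simp add: o_def)
qed

text \<open>Differentiation under the integral sign, along a curve of amplitudes.\<close>

lemma smooth_family_fc_derivative:
  assumes fam: "smooth_family \<rho> u Du"
    and \<gamma>: "\<And>s. s \<in> T \<Longrightarrow> (\<gamma> has_vector_derivative \<gamma>' s) (at s within T)"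
    and \<gamma>': "continuous_on T \<gamma>'" and T: "convex T" "s \<in> T"
    and ball: "\<And>s. s \<in> T \<Longrightarrow> \<gamma> s \<in> ball 0 \<rho>"
  shows "((\<lambda>s. fc (\<lambda>x. of_real (u (\<gamma> s) x)) m) has_vector_derivative
            fc (\<lambda>x. of_real (Du (\<gamma> s) x (\<gamma>' s))) m) (at s within T)"
proof -
  let ?f = "\<lambda>s x. complex_of_real (u (\<gamma> s) x) * cis (- (of_int m * x))"
  let ?f' = "\<lambda>s x. complex_of_real (Du (\<gamma> s) x (\<gamma>' s)) * cis (- (of_int m * x))"
  have cont: "continuous_on T \<gamma>"
    using \<gamma> by (rule continuous_on_vector_derivative)
  have "((\<lambda>s. integral (cbox 0 (2 * pi)) (?f s)) has_vector_derivative
      integral (cbox 0 (2 * pi)) (?f' s)) (at s within T)"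
  proof (rule leibniz_rule_vector_derivative)
    fix s x :: real assume s: "s \<in> T"
    have "((\<lambda>z. u z x) has_derivative Du (\<gamma> s) x) (at (\<gamma> s))"
      using fam ball s by (simp add: smooth_family_def)
    from vector_derivative_diff_chain_within[OF \<gamma>[OF s] has_derivative_at_withinI[OF this]]
    have "((\<lambda>s. u (\<gamma> s) x) has_vector_derivative Du (\<gamma> s) x (\<gamma>' s)) (at s within T)"
      by (simp add: o_def)
    then show "((\<lambda>s. ?f s x) has_vector_derivative ?f' s x) (at s within T)"
      by (intro has_vector_derivative_mult_left)
        (rule bounded_linear.has_vector_derivative[OF bounded_linear_of_real])
  next
    fix s assume s: "s \<in> T"
    have "continuous_on UNIV (u (\<gamma> s))" using fam ball s by (simp add: smooth_family_def)
    then show "?f s integrable_on cbox 0 (2 * pi)"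
      by (intro integrable_continuous continuous_intros) (rule continuous_on_subset, auto)
  next
    have "continuous_on (T \<times> cbox 0 (2 * pi)) (\<lambda>p. Du (\<gamma> (fst p)) (snd p) (\<gamma>' (fst p)))"
      using ball by (intro smooth_family_continuous_Du[OF fam] continuous_intros
        continuous_on_compose2[OF cont] continuous_on_compose2[OF \<gamma>']) auto
    then show "continuous_on (T \<times> cbox 0 (2 * pi)) (\<lambda>(s, x). ?f' s x)"
      unfolding split_beta by (intro continuous_intros)
  qed (use T in auto)
  then show ?thesis
    unfolding fc_def by (intro has_vector_derivative_divide) simp
qed

lemma smooth_family_fc_continuous:
  assumes fam: "smooth_family \<rho> u Du" and "continuous_on T f" "continuous_on T h"
    and "\<And>s. s \<in> T \<Longrightarrow> f s \<in> ball 0 \<rho>"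
  shows "continuous_on T (\<lambda>s. fc (\<lambda>x. of_real (Du (f s) x (h s))) m)"
proof -
  have "continuous_on (T \<times> cbox 0 (2 * pi)) (\<lambda>p. Du (f (fst p)) (snd p) (h (fst p)))"
    using assms by (intro smooth_family_continuous_Du[OF fam] continuous_intros
      continuous_on_compose2[OF assms(2)] continuous_on_compose2[OF assms(3)]) auto
  then have "continuous_on (T \<times> cbox 0 (2 * pi))
      (\<lambda>(s, x). complex_of_real (Du (f s) x (h s)) * cis (- (of_int m * x)))"
    unfolding split_beta by (intro continuous_intros)
  then have "continuous_on T (\<lambda>s. integral (cbox 0 (2 * pi))
      (\<lambda>x. complex_of_real (Du (f s) x (h s)) * cis (- (of_int m * x))))"
    by (rule integral_continuous_on_param)
  then show ?thesis unfolding fc_def by (intro continuous_intros) simp_all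
qed

text \<open>By compactness, the derivative of a smooth family is a bounded operator, uniformly over
  one period and over a smaller ball.\<close>

lemma smooth_family_Du_bound:
  assumes fam: "smooth_family \<rho> u Du" and "\<rho> > 0"
  obtains K where "\<And>z x v. norm z \<le> \<rho> / 2 \<Longrightarrow> x \<in> {0..2 * pi} \<Longrightarrow> \<bar>Du z x v\<bar> \<le> K * norm v"
proof -
  let ?C = "cball (0::amplitudes) (\<rho> / 2) \<times> {0..2 * pi} \<times> cball (0::amplitudes) 1"
  have "compact ?C" by (intro compact_Times compact_cball compact_Icc)
  moreover have "continuous_on ?C (\<lambda>p. Du (fst p) (fst (snd p)) (snd (snd p)))"
    using \<open>\<rho> > 0\<close> by (intro smooth_family_continuous_Du[OF fam] continuous_intros) auto
  ultimately have "bounded ((\<lambda>p. Du (fst p) (fst (snd p)) (snd (snd p))) ` ?C)"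
    by (intro compact_imp_bounded compact_continuous_image)
  then obtain K where K: "\<And>p. p \<in> ?C \<Longrightarrow> \<bar>Du (fst p) (fst (snd p)) (snd (snd p))\<bar> \<le> K"
    unfolding bounded_iff real_norm_def by blast
  have "\<bar>Du z x v\<bar> \<le> K * norm v" if "norm z \<le> \<rho> / 2" "x \<in> {0..2 * pi}" for z x v
  proof -
    have "bounded_linear (Du z x)"
      using fam that \<open>\<rho> > 0\<close> by (auto simp: smooth_family_def intro!: has_derivative_bounded_linear)
    then have lin: "linear (Du z x)" by (rule bounded_linear.linear)
    have "v = norm v *\<^sub>R sgn v" by (cases "v = 0") (simp_all add: sgn_div_norm)
    then have "Du z x v = norm v * Du z x (sgn v)" using linear_cmul[OF lin] by (metis real_scaleR_def)
    moreover have "\<bar>Du z x (sgn v)\<bar> \<le> K"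
      using K[of "(z, x, sgn v)"] that by (simp add: norm_sgn)
    ultimately show ?thesis by (simp add: abs_mult mult.commute[of K] mult_left_mono)
  qed
  then show thesis using that by blast
qed

section \<open>The linear flow of the critical amplitudes\<close>

text \<open>The flow of the linear part \<open>(i\<omega> A, -i\<omega> B)\<close> of the reduced equation, with time rescaled to have
period \<open>2\<pi>\<close>.\<close>

definition torus_flow :: "real \<Rightarrow> amplitudes \<Rightarrow> amplitudes" where
  "torus_flow s z = (cis s * fst z, cis (- s) * snd z)"

definition torus_generator :: "amplitudes \<Rightarrow> amplitudes" where
  "torus_generator z = (\<i> * fst z, - \<i> * snd z)"

lemma norm_torus_flow [simp]: "norm (torus_flow s z) = norm z"
  by (simp add: torus_flow_def norm_prod_def norm_mult)

lemma torus_flow_derivative: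
  "((\<lambda>s. torus_flow s z) has_vector_derivative torus_generator (torus_flow s z)) (at s within T)"
proof -
  have 1: "(cis has_vector_derivative \<i> * cis s) (at s within T)" for s :: real and T
    using has_vector_derivative_real_field[of exp]
    unfolding cis_conv_exp by (auto intro!: derivative_eq_intros has_vector_derivative_real_field)
  have 2: "((\<lambda>s. cis (- s)) has_vector_derivative - \<i> * cis (- s)) (at s within T)"
    unfolding cis_conv_exp by (auto intro!: derivative_eq_intros has_vector_derivative_real_field)
  show ?thesis
    unfolding torus_flow_def torus_generator_def
    using has_vector_derivative_Pair[OF has_vector_derivative_mult_left[OF 1[of s T], of "fst z"]
      has_vector_derivative_mult_left[OF 2, of "snd z"]]
    by (simp add: mult.assoc)
qed

lemma continuous_torus_flow: "continuous_on S (\<lambda>s. torus_flow s z)"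
  "continuous_on S (\<lambda>s. torus_generator (torus_flow s z))"
  unfolding torus_flow_def torus_generator_def by (intro continuous_intros)+

lemma torus_flow_2pi: "torus_flow (2 * pi) z = torus_flow 0 z"
  by (simp add: torus_flow_def flip: cis_cnj)

section \<open>The critical modes\<close>

text \<open>At criticality the matrix of the first mode has trace \<open>0\<close> and determinant \<open>c\<^sup>2 - a\<^sup>2\<close>.\<close>

lemma eigenvalue_mode_matrix_critical:
  "eigenvalue (mode_matrix a c (a + 1) 1) \<mu> \<longleftrightarrow> \<mu>\<^sup>2 = of_real (a\<^sup>2 - c\<^sup>2)"
proof -
  have char: "eigenvalue (mode_matrix a c (a + 1) 1) \<mu> \<longleftrightarrow>
      (\<exists>w1 w2. (w1 \<noteq> 0 \<or> w2 \<noteq> 0) \<and> - of_real a * w1 + \<i> * w2 = \<mu> * w1 \<and>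
         \<i> * (of_real c)\<^sup>2 * w1 + of_real a * w2 = \<mu> * w2)" (is "_ \<longleftrightarrow> ?R")
  proof
    assume "eigenvalue (mode_matrix a c (a + 1) 1) \<mu>"
    then obtain w :: "complex^2" where "w \<noteq> 0" "mode_matrix a c (a + 1) 1 *v w = \<mu> *s w"
      unfolding eigenvalue_def by blast
    then show ?R
      by (intro exI[of _ "w $ 1"] exI[of _ "w $ 2"])
        (auto simp: vec_eq_iff forall_2 matrix_vector_mult_def sum_2 mode_matrix_def)
  next
    assume ?R
    then obtain w1 w2 where w: "w1 \<noteq> 0 \<or> w2 \<noteq> 0" "- of_real a * w1 + \<i> * w2 = \<mu> * w1"
       "\<i> * (of_real c)\<^sup>2 * w1 + of_real a * w2 = \<mu> * w2" by blast
    then show "eigenvalue (mode_matrix a c (a + 1) 1) \<mu>"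
      unfolding eigenvalue_def
      by (intro exI[of _ "vector [w1, w2]"])
        (auto simp: vec_eq_iff forall_2 matrix_vector_mult_def sum_2 mode_matrix_def)
  qed
  show ?thesis
  proof
    assume "eigenvalue (mode_matrix a c (a + 1) 1) \<mu>"
    then obtain w1 w2 where w: "w1 \<noteq> 0 \<or> w2 \<noteq> 0" "- of_real a * w1 + \<i> * w2 = \<mu> * w1"
       "\<i> * (of_real c)\<^sup>2 * w1 + of_real a * w2 = \<mu> * w2" unfolding char by blast
    have "\<i> * w2 = (\<mu> + of_real a) * w1" using w(2) by (simp add: algebra_simps)
    then have w2: "w2 = - \<i> * (\<mu> + of_real a) * w1"
      by (metis (no_types, lifting) i_squared mult.assoc mult_minus_left mult_minus1 minus_minus power2_i power2_eq_square)
    then have w1: "w1 \<noteq> 0" using w(1) by auto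
    have "\<i> * (of_real c)\<^sup>2 * w1 = (\<mu> - of_real a) * w2" using w(3) by (simp add: algebra_simps)
    then have "(\<i> * w1) * (of_real c)\<^sup>2 = (\<i> * w1) * (- (\<mu> - of_real a) * (\<mu> + of_real a))"
      by (simp add: w2 algebra_simps)
    then have "(of_real c)\<^sup>2 = - (\<mu> - of_real a) * (\<mu> + of_real a)" using w1 by simp
    then show "\<mu>\<^sup>2 = of_real (a\<^sup>2 - c\<^sup>2)" by (simp add: power2_eq_square algebra_simps)
  next
    assume \<mu>: "\<mu>\<^sup>2 = of_real (a\<^sup>2 - c\<^sup>2)"
    have "\<i> * (of_real c)\<^sup>2 + of_real a * (- \<i> * (\<mu> + of_real a)) - \<mu> * (- \<i> * (\<mu> + of_real a))
        = \<i> * (\<mu>\<^sup>2 - of_real (a\<^sup>2 - c\<^sup>2))"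
      by (simp add: power2_eq_square algebra_simps)
    with \<mu> have "\<i> * (of_real c)\<^sup>2 + of_real a * (- \<i> * (\<mu> + of_real a)) = \<mu> * (- \<i> * (\<mu> + of_real a))"
      by (simp only: right_minus_eq diff_self mult_zero_right)
    moreover have "- of_real a * 1 + \<i> * (- \<i> * (\<mu> + of_real a)) = \<mu> * 1"
      by (simp add: algebra_simps)
    ultimately show "eigenvalue (mode_matrix a c (a + 1) 1) \<mu>"
      unfolding char by (intro exI[of _ 1] exI[of _ "- \<i> * (\<mu> + of_real a)"]) simp
  qed
qed

lemma critical_eigenvalues:
  assumes "\<omega> > 0" "\<omega>\<^sup>2 = c\<^sup>2 - a\<^sup>2"
  shows "beta1 a c (a + 1) = \<i> * of_real \<omega>" "beta2 a c (a + 1) = - \<i> * of_real \<omega>"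
proof -
  have ev: "eigenvalue (mode_matrix a c (a + 1) 1) \<mu> \<longleftrightarrow> \<mu> = \<i> * of_real \<omega> \<or> \<mu> = - \<i> * of_real \<omega>" for \<mu>
  proof -
    have "of_real (a\<^sup>2 - c\<^sup>2) = (\<i> * of_real \<omega> :: complex)\<^sup>2"
      using assms(2) by (simp add: power_mult_distrib flip: of_real_power)
    then show ?thesis unfolding eigenvalue_mode_matrix_critical by (metis mult_minus_left power2_eq_iff)
  qed
  show "beta1 a c (a + 1) = \<i> * of_real \<omega>" "beta2 a c (a + 1) = - \<i> * of_real \<omega>"
    unfolding beta1_def beta2_def ev using assms(1) by (auto intro!: the_equality)
qed


section \<open>The reduced vector field at criticality\<close>

locale critical_reduction =
  fixes a c \<eta> \<omega> \<rho> :: real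
    and U V :: "real \<Rightarrow> amplitudes \<Rightarrow> real \<Rightarrow> real"
    and \<Theta> :: "real \<Rightarrow> amplitudes \<Rightarrow> amplitudes" and \<zeta> \<xi> :: complex
  assumes a_pos: "0 < a" and a_less_c: "a < c" and nonresonance: "c\<^sup>2 > 4 * a * (a + 1) ^ 3 / 27"
    and \<omega>_def: "\<omega> = sqrt (c\<^sup>2 - a\<^sup>2)"
    and \<rho>_pos: "\<rho> > 0" and manifold: "center_manifold a c \<eta> (a + 1) 5 \<rho> U V"
    and near_id: "near_identity_equivariant (a + 1) 5 \<rho> \<Theta>"
    and normal_form: "brings_into_normal_form a c \<eta> (a + 1) \<rho> U V \<Theta> \<zeta> \<xi>"
begin

lemma \<omega>_pos: "\<omega> > 0" and \<omega>_sq: "\<omega>\<^sup>2 = c\<^sup>2 - a\<^sup>2"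
proof -
  have "a\<^sup>2 < c\<^sup>2" using a_pos a_less_c by (intro power_strict_mono) auto
  then show "\<omega> > 0" "\<omega>\<^sup>2 = c\<^sup>2 - a\<^sup>2" by (simp_all add: \<omega>_def)
qed

lemmas beta_critical = critical_eigenvalues[OF \<omega>_pos \<omega>_sq]

definition \<kappa> :: complex where "\<kappa> = \<i> / (of_real a + \<i> * of_real \<omega>)"

text \<open>The first Fourier coefficient of the \<open>u\<close> component, as a function of the amplitudes.  The second
  coefficient is \<open>i / (a - i\<omega>)\<close>, the negative of the conjugate of \<open>\<kappa>\<close>.\<close>

definition w :: "amplitudes \<Rightarrow> complex" where "w z = \<kappa> * fst z - cnj \<kappa> * snd z"

lemma critical_amplitude_1: "critical_amplitude a c (a + 1) z $ 1 = w z"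
  and critical_amplitude_2: "critical_amplitude a c (a + 1) z $ 2 = fst z + snd z"
  by (simp_all add: critical_amplitude_def critical_vector_def beta_critical w_def \<kappa>_def mult.commute)

abbreviation u where "u \<equiv> U (a + 1)"
abbreviation v where "v \<equiv> V (a + 1)"

definition Du :: "amplitudes \<Rightarrow> real \<Rightarrow> amplitudes \<Rightarrow> real" where
  "Du z x h = fst (frechet_derivative (\<lambda>(\<delta>, z, x). (U \<delta> z x, V \<delta> z x)) (at (a + 1, z, x)) (0, h, 0))"

definition Dv :: "amplitudes \<Rightarrow> real \<Rightarrow> amplitudes \<Rightarrow> real" where
  "Dv z x h = snd (frechet_derivative (\<lambda>(\<delta>, z, x). (U \<delta> z x, V \<delta> z x)) (at (a + 1, z, x)) (0, h, 0))"

lemma class_C_profiles: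
  "class_C 5 (ball (a + 1) \<rho> \<times> ball 0 \<rho> \<times> UNIV) (\<lambda>(\<delta>, z, x). (U \<delta> z x, V \<delta> z x))"
  using manifold unfolding center_manifold_def by blast

lemma periodic_mean_zero_profiles:
  "z \<in> ball 0 \<rho> \<Longrightarrow> periodic_mean_zero (u z)" "z \<in> ball 0 \<rho> \<Longrightarrow> periodic_mean_zero (v z)"
  using manifold \<rho>_pos unfolding center_manifold_def by auto

lemma continuous_profiles:
  assumes "z \<in> ball 0 \<rho>"
  shows "continuous_on S (u z)" "continuous_on S (v z)"
  using periodic_mean_zero_profiles[OF assms] class_C_mono[of 4 UNIV _ 0]
  by (auto simp: periodic_mean_zero_def intro: continuous_on_subset)

lemma smooth_families: "smooth_family \<rho> u Du" "smooth_family \<rho> v Dv"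
proof -
  let ?F = "\<lambda>(\<delta>, z, x). (U \<delta> z x, V \<delta> z x)"
  let ?S = "ball (a + 1) \<rho> \<times> ball (0::amplitudes) \<rho> \<times> (UNIV::real set)"
  have C1: "class_C (Suc 0) ?S ?F" using class_C_mono[OF class_C_profiles, of 1] by simp
  have der: "((\<lambda>z. ?F (a + 1, z, x)) has_derivative
      (\<lambda>h. frechet_derivative ?F (at (a + 1, z, x)) (0, h, 0))) (at z)" if "z \<in> ball 0 \<rho>" for z x
  proof -
    have "(?F has_derivative frechet_derivative ?F (at (a + 1, z, x))) (at (a + 1, z, x))"
      using that \<rho>_pos by (intro class_C_differentiable[OF C1]) auto
    moreover have "((\<lambda>z. (a + 1, z, x)) has_derivative (\<lambda>h. (0, h, 0))) (at z)"
      by (intro derivative_eq_intros) auto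
    ultimately show ?thesis using has_derivative_compose by blast
  qed
  have "continuous_on (ball 0 \<rho> \<times> UNIV \<times> UNIV)
      ((\<lambda>(p, h). frechet_derivative ?F (at p) h) \<circ> (\<lambda>(z, x, h). ((a + 1, z, x), (0, h, 0))))"
    unfolding split_beta using \<rho>_pos
    by (intro continuous_on_compose continuous_intros
        continuous_on_subset[OF class_C_continuous_derivative[OF C1, unfolded split_beta]]) auto
  then have cont: "continuous_on (ball 0 \<rho> \<times> UNIV \<times> UNIV)
      (\<lambda>(z, x, h). frechet_derivative ?F (at (a + 1, z, x)) (0, h, 0))"
    by (simp add: o_def split_beta)
  have "continuous_on (ball 0 \<rho> \<times> UNIV \<times> UNIV) (\<lambda>(z, x, h). Du z x h)"
    using continuous_on_fst[OF cont] by (simp add: Du_def split_beta)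
  moreover have "continuous_on (ball 0 \<rho> \<times> UNIV \<times> UNIV) (\<lambda>(z, x, h). Dv z x h)"
    using continuous_on_snd[OF cont] by (simp add: Dv_def split_beta)
  moreover have "((\<lambda>z. u z x) has_derivative Du z x) (at z)"
      "((\<lambda>z. v z x) has_derivative Dv z x) (at z)" if "z \<in> ball 0 \<rho>" for z x
    using has_derivative_fst[OF der[OF that, of x]] has_derivative_snd[OF der[OF that, of x]]
    by (simp_all add: Du_def[abs_def] Dv_def[abs_def])
  ultimately show "smooth_family \<rho> u Du" "smooth_family \<rho> v Dv"
    unfolding smooth_family_def using continuous_profiles by auto
qed

lemma norm_rot [simp]: "norm (rot h z) = norm z"
  by (simp add: rot_def norm_prod_def norm_mult)

text \<open>Tangency gives the first-order expansion at \<open>x = 0\<close>, with a quadratic error by smoothness.  Since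
  \<open>u z x = u (rot x z) 0\<close> and rotations are isometries, the error is uniform in \<open>x\<close>.\<close>

lemma profile_expansion:
  "vanishes 2 (\<lambda>z x. of_real (u z x) - (w z * cis x + cnj (w z) * cis (- x)))"
proof -
  let ?F = "\<lambda>(\<delta>, z, x). (U \<delta> z x, V \<delta> z x)"
  let ?S = "ball (a + 1) \<rho> \<times> ball (0::amplitudes) \<rho> \<times> (UNIV::real set)"
  let ?p0 = "(a + 1, 0 :: amplitudes, 0 :: real)"
  have C2: "class_C 2 ?S ?F" using class_C_mono[OF class_C_profiles, of 2] by simp
  have "open ?S" "?p0 \<in> ?S" using \<rho>_pos by (auto intro!: open_Times)
  then obtain K r where r: "r > 0" and K: "\<And>p. p \<in> ball ?p0 r \<Longrightarrow>
      norm (?F p - ?F ?p0 - frechet_derivative ?F (at ?p0) (p - ?p0)) \<le> K * (norm (p - ?p0))\<^sup>2"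
    using class_C_taylor[OF C2] by blast
  have "((\<lambda>z. u z 0) has_derivative Du 0 0) (at 0)"
    using smooth_families(1) \<rho>_pos by (simp add: smooth_family_def)
  moreover have "((\<lambda>z. u z 0) has_derivative (\<lambda>z. 2 * Re (w z * cis 0))) (at 0)"
    using manifold unfolding center_manifold_def critical_amplitude_1 by blast
  ultimately have "Du 0 0 = (\<lambda>z. 2 * Re (w z * cis 0))"
    by (rule has_derivative_unique)
  then have Du0: "Du 0 0 = (\<lambda>z. 2 * Re (w z))" by simp
  have u0: "u 0 x = 0" "v 0 x = 0" for x
    using manifold \<rho>_pos unfolding center_manifold_def by auto
  have at0: "\<bar>u z 0 - 2 * Re (w z)\<bar> \<le> K * norm z ^ 2" if "norm z < r" for z
  proof -
    have p: "(a + 1, z, 0) - ?p0 = (0, z, 0)" by simp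
    have "norm ((0::real), z, (0::real)) = norm z" by (simp add: norm_prod_def)
    then have "norm (?F (a + 1, z, 0) - ?F ?p0 - frechet_derivative ?F (at ?p0) (0, z, 0)) \<le> K * (norm z)\<^sup>2"
      using K[of "(a + 1, z, 0)"] that by (simp add: dist_norm norm_minus_commute p)
    then have "\<bar>fst (?F (a + 1, z, 0) - ?F ?p0 - frechet_derivative ?F (at ?p0) (0, z, 0))\<bar> \<le> K * (norm z)\<^sup>2"
      by (intro order_trans[OF norm_fst_snd_le(1)[of "_ :: real \<times> real", unfolded real_norm_def]])
    then show ?thesis using fun_cong[OF Du0, of z] u0 by (simp add: Du_def)
  qed
  have "norm (complex_of_real (u z x) - (w z * cis x + cnj (w z) * cis (- x))) \<le> K * norm z ^ 2"
    if z: "norm z < min r \<rho>" for z x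
  proof -
    have "u z x = u (rot x z) 0"
      using manifold z \<rho>_pos unfolding center_manifold_def by (simp add: dist_norm)
    moreover have "w (rot x z) = cis x * w z" by (simp add: w_def rot_def algebra_simps)
    ultimately have "\<bar>u z x - 2 * Re (w z * cis x)\<bar> \<le> K * norm z ^ 2"
      using at0[of "rot x z"] z by (simp add: mult.commute)
    moreover have "w z * cis x + cnj (w z) * cis (- x) = of_real (2 * Re (w z * cis x))"
      using complex_add_cnj[of "w z * cis x"] by (simp add: cis_cnj)
    ultimately show ?thesis by (simp del: of_real_mult flip: of_real_diff)
  qed
  then show ?thesis using r \<rho>_pos by (intro vanishesI[of "min r \<rho>"]) auto
qed

text \<open>The two equations of the system at the point \<open>z\<close> of the manifold, when \<open>X\<close> is the velocity
  of the amplitudes.\<close>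

definition system_at :: "amplitudes \<Rightarrow> amplitudes \<Rightarrow> bool" where
  "system_at z X \<longleftrightarrow> (\<forall>x. Du z x X = deriv (v z) x - a * (deriv ^^ 4) (u z) x \<and>
     Dv z x X = deriv (\<lambda>y. flux c \<eta> (u z y)) x - (a + 1) * (deriv ^^ 2) (v z) x - (deriv ^^ 4) (v z) x)"

text \<open>By the chain rule the time derivative of the lifted curve is the derivative of the profile in the
direction of the velocity; comparison with the system removes time from the problem.\<close>

lemma reduced_solution_velocity:
  assumes "reduced_solution a c \<eta> \<rho> U V (a + 1) T y" "t \<in> T" "open T"
  obtains X where "(y has_vector_derivative X) (at t)" "system_at (y t) X"
proof -
  have y: "y t \<in> ball 0 \<rho>" "y differentiable (at t)"
    using assms unfolding reduced_solution_def by auto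
  define X where "X = vector_derivative y (at t)"
  have X: "(y has_vector_derivative X) (at t)"
    using y(2) by (simp add: X_def vector_derivative_works)
  have "((\<lambda>s. u (y s) x) has_real_derivative Du (y t) x X) (at t)"
    "((\<lambda>s. v (y s) x) has_real_derivative Dv (y t) x X) (at t)" for x
  proof -
    have du: "((\<lambda>z. u z x) has_derivative Du (y t) x) (at (y t))"
      and dv: "((\<lambda>z. v z x) has_derivative Dv (y t) x) (at (y t))"
      using smooth_families y(1) unfolding smooth_family_def by auto
    show "((\<lambda>s. u (y s) x) has_real_derivative Du (y t) x X) (at t)"
      "((\<lambda>s. v (y s) x) has_real_derivative Dv (y t) x X) (at t)"
      using vector_derivative_diff_chain_within[OF X has_derivative_at_withinI[OF du]]
        vector_derivative_diff_chain_within[OF X has_derivative_at_withinI[OF dv]]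
      unfolding has_real_derivative_iff_has_vector_derivative by (simp_all add: o_def)
  qed
  moreover have "((\<lambda>s. u (y s) x) has_real_derivative deriv (v (y t)) x - a * (deriv ^^ 4) (u (y t)) x) (at t)"
    "((\<lambda>s. v (y s) x) has_real_derivative deriv (\<lambda>x. flux c \<eta> (u (y t) x)) x
        - (a + 1) * (deriv ^^ 2) (v (y t)) x - (deriv ^^ 4) (v (y t)) x) (at t)" for x
    using assms unfolding reduced_solution_def solves_system_def by auto
  ultimately have "system_at (y t) X"
    unfolding system_at_def by (blast intro: DERIV_unique)
  with X show thesis by (rule that)
qed

abbreviation u_hat where "u_hat z m \<equiv> fc (\<lambda>x. of_real (u z x)) m"
abbreviation v_hat where "v_hat z m \<equiv> fc (\<lambda>x. of_real (v z x)) m"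

definition nonlinearity :: "amplitudes \<Rightarrow> int \<Rightarrow> complex" where
  "nonlinearity z m = fc (\<lambda>x. of_real (u z x) ^ 2) m / 2 + of_real \<eta> / 3 * fc (\<lambda>x. of_real (u z x) ^ 3) m"

lemma system_at_modes:
  assumes z: "z \<in> ball 0 \<rho>" and X: "system_at z X"
  shows "fc (\<lambda>x. of_real (Du z x X)) m = \<i> * of_int m * v_hat z m - of_real a * of_int m ^ 4 * u_hat z m"
    and "fc (\<lambda>x. of_real (Dv z x X)) m = \<i> * of_int m * ((of_real c)\<^sup>2 * u_hat z m + nonlinearity z m)
          + (of_real (a + 1) * of_int m ^ 2 - of_int m ^ 4) * v_hat z m"
proof -
  have pu: "class_C 4 UNIV (u z)" "\<And>x. u z (x + 2 * pi) = u z x"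
   and pv: "class_C 4 UNIV (v z)" "\<And>x. v z (x + 2 * pi) = v z x"
    using periodic_mean_zero_profiles[OF z] by (auto simp: periodic_mean_zero_def)
  have u1: "class_C 1 UNIV (u z)" and v1: "class_C 1 UNIV (v z)" and v2: "class_C 2 UNIV (v z)"
    by (rule class_C_mono[OF pu(1)] class_C_mono[OF pv(1)]; simp)+
  have [continuous_intros]: "continuous_on {0..2 * pi} ((deriv ^^ 4) (u z))"
    "continuous_on {0..2 * pi} ((deriv ^^ 4) (v z))" "continuous_on {0..2 * pi} ((deriv ^^ 2) (v z))"
    "continuous_on {0..2 * pi} (deriv (v z))" "continuous_on {0..2 * pi} (deriv (u z))"
    "continuous_on {0..2 * pi} (u z)"
    using fc_iterated_deriv(2)[OF pu] fc_iterated_deriv(2)[OF pv] fc_iterated_deriv(2)[OF v2 pv(2)]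
      fc_iterated_deriv(2)[OF v1 pv(2)] fc_iterated_deriv(2)[OF u1 pu(2)] continuous_profiles[OF z]
    by (auto intro: continuous_on_subset)
  have i4: "(\<i> * of_int m) ^ 4 = of_int m ^ 4" "(\<i> * of_int m) ^ 2 = - (of_int m ^ 2)"
    by (simp_all add: power_mult_distrib)
  have "fc (\<lambda>x. of_real (Du z x X)) m
      = fc (\<lambda>x. of_real (deriv (v z) x) - of_real a * of_real ((deriv ^^ 4) (u z) x)) m"
    using X by (simp add: system_at_def)
  also have "\<dots> = fc (\<lambda>x. of_real (deriv (v z) x)) m - of_real a * fc (\<lambda>x. of_real ((deriv ^^ 4) (u z) x)) m"
    by (subst fc_diff) (auto intro!: continuous_intros simp: fc_cmult)
  finally show "fc (\<lambda>x. of_real (Du z x X)) m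
      = \<i> * of_int m * v_hat z m - of_real a * of_int m ^ 4 * u_hat z m"
    using fc_iterated_deriv(1)[OF pu, of m] fc_iterated_deriv(1)[OF v1 pv(2), of m] by (simp add: i4)
  define g where "g x = (c\<^sup>2 + u z x + \<eta> * (u z x)\<^sup>2) * deriv (u z) x" for x
  have g: "((\<lambda>y. flux c \<eta> (u z y)) has_real_derivative g x) (at x)" for x
    unfolding flux_def g_def using class_C_deriv(2)[of 0 "u z" x] u1
    by (auto intro!: derivative_eq_intros simp: algebra_simps power2_eq_square)
  have "fc (\<lambda>x. of_real (g x)) m = \<i> * of_int m * fc (\<lambda>x. of_real (flux c \<eta> (u z x))) m"
  proof (rule fc_derivative)
    show "((\<lambda>x. complex_of_real (flux c \<eta> (u z x))) has_vector_derivative of_real (g x)) (at x within {0..2 * pi})" for x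
      using g[of x] by (intro bounded_linear.has_vector_derivative[OF bounded_linear_of_real])
        (simp add: has_real_derivative_iff_has_vector_derivative has_vector_derivative_at_within)
    show "complex_of_real (flux c \<eta> (u z (2 * pi))) = of_real (flux c \<eta> (u z 0))" using pu(2)[of 0] by simp
  qed
  also have "(\<lambda>x. complex_of_real (flux c \<eta> (u z x))) =
     (\<lambda>x. (of_real c)\<^sup>2 * of_real (u z x) + (1 / 2 * of_real (u z x) ^ 2 + of_real \<eta> / 3 * of_real (u z x) ^ 3))"
    by (simp add: flux_def fun_eq_iff add.assoc)
  also have "fc \<dots> m = (of_real c)\<^sup>2 * u_hat z m + nonlinearity z m"
    unfolding nonlinearity_def
    by ((subst fc_add; (intro continuous_intros)?)+) (simp only: fc_cmult, simp)
  finally have fg: "fc (\<lambda>x. of_real (g x)) m = \<i> * of_int m * ((of_real c)\<^sup>2 * u_hat z m + nonlinearity z m)" .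
  have [continuous_intros]: "continuous_on {0..2 * pi} g"
    unfolding g_def by (intro continuous_intros)
  have "fc (\<lambda>x. of_real (Dv z x X)) m
      = fc (\<lambda>x. of_real (g x) - of_real (a + 1) * of_real ((deriv ^^ 2) (v z) x)
            - of_real ((deriv ^^ 4) (v z) x)) m"
    using X DERIV_imp_deriv[OF g] by (simp add: system_at_def)
  also have "\<dots> = fc (\<lambda>x. of_real (g x)) m - of_real (a + 1) * fc (\<lambda>x. of_real ((deriv ^^ 2) (v z) x)) m
      - fc (\<lambda>x. of_real ((deriv ^^ 4) (v z) x)) m"
    by ((subst fc_diff; (intro continuous_intros)?)+) (simp add: fc_cmult)
  finally show "fc (\<lambda>x. of_real (Dv z x X)) m = \<i> * of_int m * ((of_real c)\<^sup>2 * u_hat z m + nonlinearity z m)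
          + (of_real (a + 1) * of_int m ^ 2 - of_int m ^ 4) * v_hat z m"
    using fc_iterated_deriv(1)[OF pv, of m] fc_iterated_deriv(1)[OF v2 pv(2), of m]
    by (simp add: i4 fg algebra_simps)
qed

lemma profile_modes:
  assumes z: "z \<in> ball 0 \<rho>"
  shows "u_hat z 1 = w z" "v_hat z 1 = fst z + snd z" "u_hat z 0 = 0"
proof -
  have "vector [fourier_coeff (u z) 1, fourier_coeff (v z) 1] = critical_amplitude a c (a + 1) z"
    using manifold z \<rho>_pos unfolding center_manifold_def by simp
  then show "u_hat z 1 = w z" "v_hat z 1 = fst z + snd z"
    unfolding vec_eq_iff forall_2 by (simp_all add: critical_amplitude_1 critical_amplitude_2 fourier_coeff_eq_fc)
  have "integral {0..2 * pi} (\<lambda>x. complex_of_real (u z x)) = of_real (integral {0..2 * pi} (u z))"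
    using integral_linear[OF integrable_continuous_real[OF continuous_profiles(1)[OF z]] bounded_linear_of_real]
    by (simp add: o_def)
  then show "u_hat z 0 = 0"
    using periodic_mean_zero_profiles[OF z] by (simp add: fc_def periodic_mean_zero_def)
qed

text \<open>The amplitudes are read off linearly from the first Fourier mode, so the first mode of a tangent
  vector is the same linear function of its direction: differentiate along a line.\<close>

lemma tangent_first_mode:
  assumes z: "z \<in> ball 0 \<rho>"
  shows "fc (\<lambda>x. of_real (Du z x h)) 1 = w h" "fc (\<lambda>x. of_real (Dv z x h)) 1 = fst h + snd h"
proof -
  define d where "d = (\<rho> - norm z) / (norm h + 1)"
  have d: "d > 0" using z by (auto simp: d_def add_nonneg_pos)
  define T where "T = {-d<..<d}"
  have T: "open T" "convex T" "0 \<in> T" using d by (auto simp: T_def)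
  have ball: "z + s *\<^sub>R h \<in> ball 0 \<rho>" if "s \<in> T" for s
  proof -
    have "norm (z + s *\<^sub>R h) \<le> norm z + \<bar>s\<bar> * norm h" by (metis norm_scaleR norm_triangle_ineq)
    also have "\<bar>s\<bar> * norm h \<le> \<bar>s\<bar> * (norm h + 1)" by (intro mult_left_mono) auto
    also have "\<bar>s\<bar> * (norm h + 1) < d * (norm h + 1)"
      using that by (intro mult_strict_right_mono) (auto simp: T_def add_nonneg_pos)
    also have "d * (norm h + 1) = \<rho> - norm z" by (simp add: d_def add_nonneg_eq_0_iff)
    finally show ?thesis by simp
  qed
  have line: "((\<lambda>s. z + s *\<^sub>R h) has_vector_derivative h) (at s within T)" for s
    by (auto intro!: derivative_eq_intros)
  have "((\<lambda>s. w z + s *\<^sub>R w h) has_vector_derivative fc (\<lambda>x. of_real (Du z x h)) 1) (at 0 within T)"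
  proof (rule has_vector_derivative_transform[OF T(3)])
    show "((\<lambda>s. u_hat (z + s *\<^sub>R h) 1) has_vector_derivative fc (\<lambda>x. of_real (Du z x h)) 1) (at 0 within T)"
      using smooth_family_fc_derivative[OF smooth_families(1) line continuous_on_const T(2,3) ball, of 1] by simp
    show "w z + s *\<^sub>R w h = u_hat (z + s *\<^sub>R h) 1" if "s \<in> T" for s
      using profile_modes(1)[OF ball[OF that]] by (simp add: w_def scaleR_conv_of_real algebra_simps)
  qed
  moreover have "((\<lambda>s. w z + s *\<^sub>R w h) has_vector_derivative w h) (at 0 within T)"
    by (auto intro!: derivative_eq_intros)
  ultimately show "fc (\<lambda>x. of_real (Du z x h)) 1 = w h"
    using T by (metis at_within_open vector_derivative_unique_at)
  have "((\<lambda>s. (fst z + snd z) + s *\<^sub>R (fst h + snd h)) has_vector_derivative fc (\<lambda>x. of_real (Dv z x h)) 1) (at 0 within T)"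
  proof (rule has_vector_derivative_transform[OF T(3)])
    show "((\<lambda>s. v_hat (z + s *\<^sub>R h) 1) has_vector_derivative fc (\<lambda>x. of_real (Dv z x h)) 1) (at 0 within T)"
      using smooth_family_fc_derivative[OF smooth_families(2) line continuous_on_const T(2,3) ball, of 1] by simp
    show "(fst z + snd z) + s *\<^sub>R (fst h + snd h) = v_hat (z + s *\<^sub>R h) 1" if "s \<in> T" for s
      using profile_modes(2)[OF ball[OF that]] by (simp add: scaleR_conv_of_real algebra_simps)
  qed
  moreover have "((\<lambda>s. (fst z + snd z) + s *\<^sub>R (fst h + snd h)) has_vector_derivative (fst h + snd h)) (at 0 within T)"
    by (auto intro!: derivative_eq_intros)
  ultimately show "fc (\<lambda>x. of_real (Dv z x h)) 1 = fst h + snd h"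
    using T by (metis at_within_open vector_derivative_unique_at)
qed

text \<open>The reduced vector field in closed form.  The first mode obeys the linear system with matrix
\<open>M\<^sub>1\<close>, forced in its second component by \<open>i N\<close> with \<open>N = nonlinearity z 1\<close>; the factors
\<open>(a + i\<omega>) / (2\<omega>)\<close> and \<open>- (a - i\<omega>) / (2\<omega>)\<close> are the coordinates of \<open>(0, i)\<close> in the basis of the
two critical eigenvectors.\<close>

definition velocity :: "amplitudes \<Rightarrow> amplitudes" where
  "velocity z =
     (\<i> * of_real \<omega> * fst z + (of_real a + \<i> * of_real \<omega>) / (2 * of_real \<omega>) * nonlinearity z 1,
      - \<i> * of_real \<omega> * snd z - (of_real a - \<i> * of_real \<omega>) / (2 * of_real \<omega>) * nonlinearity z 1)"

lemma a_i\<omega>: "(of_real a + \<i> * of_real \<omega>) * (of_real a - \<i> * of_real \<omega>) = (of_real c :: complex)\<^sup>2"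
  "of_real a + \<i> * of_real \<omega> \<noteq> (0::complex)" "of_real a - \<i> * of_real \<omega> \<noteq> (0::complex)"
proof -
  show "(of_real a + \<i> * of_real \<omega>) * (of_real a - \<i> * of_real \<omega>) = (of_real c :: complex)\<^sup>2"
    using \<omega>_sq by (simp add: complex_eq_iff power2_eq_square algebra_simps)
  show "of_real a + \<i> * of_real \<omega> \<noteq> (0::complex)" "of_real a - \<i> * of_real \<omega> \<noteq> (0::complex)"
    using a_pos by (simp_all add: complex_eq_iff)
qed

lemma \<kappa>_mult: "\<kappa> * (of_real a + \<i> * of_real \<omega>) = \<i>" "cnj \<kappa> * (of_real a - \<i> * of_real \<omega>) = - \<i>"
  using a_i\<omega> by (simp_all add: \<kappa>_def)

lemma system_at_unique:
  assumes z: "z \<in> ball 0 \<rho>" and X: "system_at z X"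
  shows "X = velocity z"
proof -
  obtain p q where pq: "X = (p, q)" by force
  obtain A B where AB: "z = (A, B)" by force
  define N where "N = nonlinearity z 1"
  define al where "al = (of_real a :: complex)"
  define om where "om = (of_real \<omega> :: complex)"
  define cc where "cc = (of_real c :: complex)"
  define I where "I = \<i>"
  have I: "I * I = -1" by (simp add: I_def)
  have om: "om \<noteq> 0" using \<omega>_pos by (simp add: om_def)
  have k: "\<kappa> * (al + I * om) = I" "cnj \<kappa> * (al - I * om) = - I"
    using \<kappa>_mult by (simp_all add: al_def I_def om_def)
  have c2: "cc\<^sup>2 = al\<^sup>2 + om\<^sup>2"
    using a_i\<omega>(1) I by (simp add: al_def I_def om_def cc_def power2_eq_square algebra_simps)
  have e1: "\<kappa> * p - cnj \<kappa> * q = I * (A + B) - al * (\<kappa> * A - cnj \<kappa> * B)"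
    using system_at_modes(1)[OF z X, of 1] tangent_first_mode(1)[OF z] profile_modes[OF z]
    by (simp add: w_def pq AB al_def I_def)
  have e2: "p + q = I * (cc\<^sup>2 * (\<kappa> * A - cnj \<kappa> * B) + N) + al * (A + B)"
    using system_at_modes(2)[OF z X, of 1] tangent_first_mode(2)[OF z] profile_modes[OF z]
    by (simp add: w_def pq AB al_def I_def N_def cc_def)
  have cc: "cc\<^sup>2 = (al + I * om) * (al - I * om)" using I c2 by algebra
  have kc: "\<kappa> * cc\<^sup>2 = I * (al - I * om)" unfolding cc mult.assoc[symmetric] k(1) ..
  have kc': "cnj \<kappa> * cc\<^sup>2 = - I * (al + I * om)"
    unfolding cc mult.commute[of "al + I * om"] mult.assoc[symmetric] k(2) ..
  have e1': "I * (al - I * om) * p + I * (al + I * om) * q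
     = I * cc\<^sup>2 * (A + B) - al * (I * (al - I * om) * A + I * (al + I * om) * B)"
    using e1 kc kc' by algebra
  have e2': "p + q = I * (I * (al - I * om) * A + I * (al + I * om) * B + N) + al * (A + B)"
    using e2 kc kc' by algebra
  have "2 * om * p = 2 * om * (I * om * A) + (al + I * om) * N"
    using e1' e2' I c2 by algebra
  moreover have "2 * om * q = 2 * om * (- I * om * B) - (al - I * om) * N"
    using e1' e2' I c2 by algebra
  ultimately have "p = I * om * A + (al + I * om) / (2 * om) * N" "q = - I * om * B - (al - I * om) / (2 * om) * N"
    using om by (simp_all add: field_simps)
  then show ?thesis by (simp add: velocity_def pq AB N_def al_def I_def om_def)
qed

lemma manifold_solution:
  assumes z: "z \<in> ball 0 \<rho>"
  obtains e y where "e > 0" "y 0 = z" "reduced_solution a c \<eta> \<rho> U V (a + 1) {-e<..<e} y"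
    "(y has_vector_derivative velocity z) (at 0)" "system_at z (velocity z)"
proof -
  obtain e y where y: "e > 0" "y 0 = z" "reduced_solution a c \<eta> \<rho> U V (a + 1) {-e<..<e} y"
    using manifold z \<rho>_pos unfolding center_manifold_def by (metis centre_in_ball)
  have "0 \<in> {-e<..<e}" using y(1) by simp
  from reduced_solution_velocity[OF y(3) this open_greaterThanLessThan]
  obtain X where X: "(y has_vector_derivative X) (at 0)" "system_at z X"
    unfolding y(2) by blast
  with system_at_unique[OF z X(2)] y show thesis by (intro that) auto
qed

section \<open>Expansion of the nonlinear terms\<close>

text \<open>What the profile adds to its linear part.\<close>

definition defect :: "amplitudes \<Rightarrow> real \<Rightarrow> complex" where
  "defect z x = of_real (u z x) - (w z * cis x + cnj (w z) * cis (- x))"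

lemma vanishes_w: "vanishes 1 (\<lambda>z x. w z)"
  unfolding w_def by (intro vanishes_diff vanishes_cmult vanishes_fst vanishes_snd)

lemma vanishes_defect: "vanishes 2 defect"
  using profile_expansion unfolding defect_def[abs_def] .

lemma continuous_defect: "z \<in> ball 0 \<rho> \<Longrightarrow> continuous_on S (defect z)"
  unfolding defect_def[abs_def] by (intro continuous_intros continuous_profiles)

lemma fc_defect:
  assumes "z \<in> ball 0 \<rho>"
  shows "fc (defect z) 0 = 0" "fc (defect z) 2 = u_hat z 2"
proof -
  have "fc (\<lambda>x. w z * cis x + cnj (w z) * cis (- x)) m = (if m = 1 then w z else if m = -1 then cnj (w z) else 0)" for m
    using fc_trig_poly[of "[(w z, 1), (cnj (w z), -1)]" m] by simp
  moreover have "fc (defect z) m = u_hat z m - fc (\<lambda>x. w z * cis x + cnj (w z) * cis (- x)) m" for m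
    unfolding defect_def[abs_def] by (intro fc_diff continuous_intros continuous_profiles assms)
  ultimately show "fc (defect z) 0 = 0" "fc (defect z) 2 = u_hat z 2"
    using profile_modes(3)[OF assms] by auto
qed

lemma vanishes_cis: "vanishes 0 (\<lambda>z x. cis (f x))"
  by (rule vanishes_bounded[of _ 1]) simp

lemma vanishes_leading: "vanishes 1 (\<lambda>z x. w z * cis x + cnj (w z) * cis (- x))"
  using vanishes_mult[OF vanishes_w vanishes_cis] vanishes_mult[OF vanishes_cnj[OF vanishes_w] vanishes_cis]
  by (intro vanishes_add) simp_all

lemma vanishes_u: "vanishes 1 (\<lambda>z x. of_real (u z x))"
  using vanishes_add[OF vanishes_mono[OF vanishes_defect, of 1] vanishes_leading] by (simp add: defect_def)

lemma vanishes_fc_ball: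
  assumes "vanishes k f" "\<And>z. z \<in> ball 0 \<rho> \<Longrightarrow> continuous_on {0..2 * pi} (f z)"
  shows "vanishes k (\<lambda>z x. fc (f z) m)"
  using assms \<rho>_pos by (intro vanishes_fc) auto

lemma vanishes_cong_ball:
  "vanishes k g \<Longrightarrow> (\<And>z x. z \<in> ball 0 \<rho> \<Longrightarrow> f z x = g z x) \<Longrightarrow> vanishes k f"
  using \<rho>_pos by (rule_tac vanishes_cong[of \<rho> f g]) auto

lemma vanishes_u_hat_2: "vanishes 2 (\<lambda>z x. u_hat z 2)"
  by (rule vanishes_cong_ball[OF vanishes_fc_ball[OF vanishes_defect, of 2]])
    (auto simp: fc_defect intro: continuous_defect)

lemma fc_square_leading:
  "fc (\<lambda>x. (w z * cis x + cnj (w z) * cis (- x))\<^sup>2) m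
    = (if m = 2 then (w z)\<^sup>2 else 0) + (if m = 0 then 2 * w z * cnj (w z) else 0) + (if m = -2 then (cnj (w z))\<^sup>2 else 0)"
  unfolding cis_square_identity fc_trig_poly by simp

text \<open>The square of the linear part has only the modes \<open>0, 2, -2\<close>.  In the cross term the linear part
couples to the modes \<open>0\<close> and \<open>2\<close> of the defect, and mode \<open>0\<close> is absent by the mean-zero condition.\<close>

lemma fc_square_1:
  assumes z: "z \<in> ball 0 \<rho>"
  shows "fc (\<lambda>x. (of_real (u z x))\<^sup>2) 1 = 2 * cnj (w z) * u_hat z 2 + fc (\<lambda>x. (defect z x)\<^sup>2) 1"
proof -
  note [continuous_intros] = continuous_defect[OF z]
  have "(\<lambda>x. (complex_of_real (u z x))\<^sup>2) = (\<lambda>x. (w z * cis x + cnj (w z) * cis (- x))\<^sup>2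
     + (2 * w z * (cis (of_int 1 * x) * defect z x) + (2 * cnj (w z) * (cis (of_int (-1) * x) * defect z x) + (defect z x)\<^sup>2)))"
    by (rule ext) (simp add: defect_def power2_eq_square algebra_simps)
  moreover have "fc \<dots> 1 = fc (\<lambda>x. (w z * cis x + cnj (w z) * cis (- x))\<^sup>2) 1
     + (2 * w z * fc (defect z) (1 - 1) + (2 * cnj (w z) * fc (defect z) (1 - (-1)) + fc (\<lambda>x. (defect z x)\<^sup>2) 1))"
  proof -
    have 1: "continuous_on {0..2 * pi} (\<lambda>x. (w z * cis x + cnj (w z) * cis (- x))\<^sup>2)"
      by (intro continuous_intros)
    have 2: "continuous_on {0..2 * pi} (\<lambda>x. k * (cis (of_int m * x) * defect z x))" for k m
      by (intro continuous_intros)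
    have 3: "continuous_on {0..2 * pi} (\<lambda>x. (defect z x)\<^sup>2)" by (intro continuous_intros)
    show ?thesis
      unfolding fc_add[OF 1 continuous_on_add[OF 2 continuous_on_add[OF 2 3]]]
        fc_add[OF 2 continuous_on_add[OF 2 3]] fc_add[OF 2 3] fc_cmult fc_cis_mult ..
  qed
  moreover have "fc (\<lambda>x. (w z * cis x + cnj (w z) * cis (- x))\<^sup>2) 1 = 0"
    unfolding fc_square_leading by simp
  moreover have "(1::int) - 1 = 0" "(1::int) - (-1) = 2" by simp_all
  ultimately show ?thesis by (simp only: fc_defect[OF z] mult_zero_right add_0)
qed

text \<open>The effective cubic forcing of the critical mode: the quadratic term of the flux acts through the
second harmonic that it generates, the cubic term acts directly.\<close>

lemma nonlinearity_1:
  "vanishes 4 (\<lambda>z x. nonlinearity z 1 - (cnj (w z) * u_hat z 2 + of_real \<eta> * ((w z)\<^sup>2 * cnj (w z))))"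
proof -
  let ?p = "\<lambda>z x. w z * cis x + cnj (w z) * cis (- x)"
  let ?q = "\<lambda>z x. defect z x * ((of_real (u z x))\<^sup>2 + of_real (u z x) * ?p z x + (?p z x)\<^sup>2)"
  have "vanishes (2 + 2) (\<lambda>z x. defect z x * defect z x)" by (intro vanishes_mult vanishes_defect)
  then have "vanishes 4 (\<lambda>z x. (defect z x)\<^sup>2)" by (simp add: power2_eq_square)
  then have 1: "vanishes 4 (\<lambda>z x. fc (\<lambda>x. (defect z x)\<^sup>2) 1)"
    by (rule vanishes_fc_ball) (intro continuous_intros continuous_defect)
  have "vanishes (2 + (1 + 1)) (\<lambda>z x. defect z x * (of_real (u z x) * of_real (u z x) + of_real (u z x) * ?p z x + ?p z x * ?p z x))"
    by (intro vanishes_mult vanishes_add vanishes_defect vanishes_u vanishes_leading)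
  then have "vanishes 4 ?q" by (simp add: power2_eq_square)
  then have 2: "vanishes 4 (\<lambda>z x. fc (?q z) 1)"
    by (rule vanishes_fc_ball) (intro continuous_intros continuous_defect continuous_profiles)
  have eq: "nonlinearity z 1 - (cnj (w z) * u_hat z 2 + of_real \<eta> * ((w z)\<^sup>2 * cnj (w z)))
      = 1 / 2 * fc (\<lambda>x. (defect z x)\<^sup>2) 1 + of_real \<eta> / 3 * fc (?q z) 1" if z: "z \<in> ball 0 \<rho>" for z
  proof -
    have "fc (\<lambda>x. (?p z x)\<^sup>2 * ?p z x) 1 = 3 * ((w z)\<^sup>2 * cnj (w z))"
      unfolding cis_cube_identity fc_trig_poly by (simp add: power2_eq_square)
    moreover have "fc (?q z) 1 = fc (\<lambda>x. of_real (u z x) ^ 3 - (?p z x)\<^sup>2 * ?p z x) 1"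
      by (rule arg_cong[of _ _ "\<lambda>f. fc f 1"], rule ext)
        (simp add: defect_def power2_eq_square power3_eq_cube algebra_simps)
    moreover have "\<dots> = fc (\<lambda>x. of_real (u z x) ^ 3) 1 - fc (\<lambda>x. (?p z x)\<^sup>2 * ?p z x) 1"
      by (intro fc_diff continuous_intros continuous_profiles z)
    ultimately have "fc (\<lambda>x. of_real (u z x) ^ 3) 1 = 3 * ((w z)\<^sup>2 * cnj (w z)) + fc (?q z) 1" by simp
    then show ?thesis unfolding nonlinearity_def fc_square_1[OF z] by (simp add: field_simps)
  qed
  show ?thesis
    by (rule vanishes_cong_ball[OF vanishes_add[OF vanishes_cmult[OF 1] vanishes_cmult[OF 2]]]) (rule eq)
qed

lemma nonlinearity_2: "vanishes 3 (\<lambda>z x. nonlinearity z 2 - (w z)\<^sup>2 / 2)"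
proof -
  let ?p = "\<lambda>z x. w z * cis x + cnj (w z) * cis (- x)"
  let ?q = "\<lambda>z x. defect z x * (of_real (u z x) + ?p z x)"
  have "vanishes (2 + 1) ?q"
    by (intro vanishes_mult vanishes_add vanishes_defect vanishes_u vanishes_leading)
  then have 1: "vanishes 3 (\<lambda>z x. fc (?q z) 2)"
    by (intro vanishes_fc_ball continuous_intros continuous_defect continuous_profiles) simp
  have "vanishes (1 + (1 + 1)) (\<lambda>z x. of_real (u z x) * (of_real (u z x) * of_real (u z x)))"
    by (intro vanishes_mult vanishes_u)
  then have "vanishes 3 (\<lambda>z x. of_real (u z x) ^ 3)"
    by (simp add: power3_eq_cube mult.assoc numeral_3_eq_3)
  then have 2: "vanishes 3 (\<lambda>z x. fc (\<lambda>x. of_real (u z x) ^ 3) 2)"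
    by (rule vanishes_fc_ball) (intro continuous_intros continuous_profiles)
  have eq: "nonlinearity z 2 - (w z)\<^sup>2 / 2
      = 1 / 2 * fc (?q z) 2 + of_real \<eta> / 3 * fc (\<lambda>x. of_real (u z x) ^ 3) 2" if z: "z \<in> ball 0 \<rho>" for z
  proof -
    have "fc (?q z) 2 = fc (\<lambda>x. (of_real (u z x))\<^sup>2 - (?p z x)\<^sup>2) 2"
      by (rule arg_cong[of _ _ "\<lambda>f. fc f 2"], rule ext)
        (simp add: defect_def power2_eq_square algebra_simps)
    also have "\<dots> = fc (\<lambda>x. (of_real (u z x))\<^sup>2) 2 - fc (\<lambda>x. (?p z x)\<^sup>2) 2"
      by (intro fc_diff continuous_intros continuous_profiles z)
    also have "fc (\<lambda>x. (?p z x)\<^sup>2) 2 = (w z)\<^sup>2" unfolding fc_square_leading by simp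
    finally have "fc (?q z) 2 = fc (\<lambda>x. (of_real (u z x))\<^sup>2) 2 - (w z)\<^sup>2" .
    moreover have "s / 2 + y - t / 2 = 1 / 2 * (s - t) + y" for s t y :: complex
      by (simp add: diff_divide_distrib)
    ultimately show ?thesis unfolding nonlinearity_def by (simp only:)
  qed
  show ?thesis
    by (rule vanishes_cong_ball[OF vanishes_add[OF vanishes_cmult[OF 1] vanishes_cmult[OF 2]]]) (rule eq)
qed

lemma vanishes_nonlinearity_1: "vanishes 3 (\<lambda>z x. nonlinearity z 1)"
proof -
  have "vanishes (1 + 2) (\<lambda>z x. cnj (w z) * u_hat z 2)"
    by (intro vanishes_mult vanishes_cnj vanishes_w vanishes_u_hat_2)
  moreover have "vanishes (1 + 1 + 1) (\<lambda>z x. w z * w z * cnj (w z))"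
    by (intro vanishes_mult vanishes_cnj vanishes_w)
  ultimately have "vanishes 3 (\<lambda>z x. (nonlinearity z 1 - (cnj (w z) * u_hat z 2 + of_real \<eta> * ((w z)\<^sup>2 * cnj (w z))))
      + (cnj (w z) * u_hat z 2 + of_real \<eta> * ((w z)\<^sup>2 * cnj (w z))))"
    using vanishes_mono[OF nonlinearity_1, of 3]
    by (intro vanishes_add vanishes_cmult) (simp_all add: power2_eq_square numeral_3_eq_3)
  then show ?thesis by simp
qed

section \<open>Averaging the second harmonic\<close>

abbreviation average where "average g z n \<equiv> fc (\<lambda>s. g (torus_flow s z)) n"

lemma torus_flow_ball: "z \<in> ball 0 \<rho> \<Longrightarrow> torus_flow s z \<in> ball 0 \<rho>"
  by simp

lemma vanishes_average:
  assumes "vanishes k (\<lambda>z x. f z)" "\<And>z. z \<in> ball 0 \<rho> \<Longrightarrow> continuous_on {0..2 * pi} (\<lambda>s. f (torus_flow s z))"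
  shows "vanishes k (\<lambda>z x. average f z n)"
  using vanishes_isometry[OF assms(1), of torus_flow] assms(2)
  by (intro vanishes_fc_ball) auto

lemma w_torus_flow:
  "w (torus_flow s z) = \<kappa> * fst z * cis s + (- cnj \<kappa> * snd z) * cis (- s)"
  "cnj (w (torus_flow s z)) = (- \<kappa> * cnj (snd z)) * cis s + cnj \<kappa> * cnj (fst z) * cis (- s)"
  by (simp_all add: w_def torus_flow_def cis_cnj algebra_simps)

abbreviation Du2 where "Du2 z h \<equiv> fc (\<lambda>x. of_real (Du z x h)) 2"
abbreviation Dv2 where "Dv2 z h \<equiv> fc (\<lambda>x. of_real (Dv z x h)) 2"

lemma hat_derivative:
  assumes "z \<in> ball 0 \<rho>" "s \<in> {0..2 * pi}"
  shows "((\<lambda>s. u_hat (torus_flow s z) 2) has_vector_derivative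
       Du2 (torus_flow s z) (torus_generator (torus_flow s z))) (at s within {0..2 * pi})"
    and "((\<lambda>s. v_hat (torus_flow s z) 2) has_vector_derivative
       Dv2 (torus_flow s z) (torus_generator (torus_flow s z))) (at s within {0..2 * pi})"
  using assms
  by (auto intro!: smooth_family_fc_derivative[OF smooth_families(1)] smooth_family_fc_derivative[OF smooth_families(2)]
      torus_flow_derivative continuous_torus_flow)

lemma continuous_hat:
  assumes "z \<in> ball 0 \<rho>"
  shows "continuous_on {0..2 * pi} (\<lambda>s. u_hat (torus_flow s z) 2)"
    "continuous_on {0..2 * pi} (\<lambda>s. v_hat (torus_flow s z) 2)"
  by (rule continuous_on_vector_derivative[OF hat_derivative(1)[OF assms]], assumption)
    (rule continuous_on_vector_derivative[OF hat_derivative(2)[OF assms]], assumption)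

lemma continuous_D2:
  assumes "z \<in> ball 0 \<rho>"
  shows "continuous_on {0..2 * pi} (\<lambda>s. Du2 (torus_flow s z) (torus_generator (torus_flow s z)))"
    "continuous_on {0..2 * pi} (\<lambda>s. Dv2 (torus_flow s z) (torus_generator (torus_flow s z)))"
  using assms by (auto intro!: smooth_family_fc_continuous[OF smooth_families(1)]
      smooth_family_fc_continuous[OF smooth_families(2)] continuous_torus_flow)

lemma average_D2:
  assumes "z \<in> ball 0 \<rho>"
  shows "average (\<lambda>z. Du2 z (torus_generator z)) z n = \<i> * of_int n * average (\<lambda>z. u_hat z 2) z n"
    "average (\<lambda>z. Dv2 z (torus_generator z)) z n = \<i> * of_int n * average (\<lambda>z. v_hat z 2) z n"
  by (auto intro!: fc_derivative hat_derivative[OF assms] simp: torus_flow_2pi)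

definition cubic_part :: "amplitudes \<Rightarrow> amplitudes" where
  "cubic_part z = velocity z - \<omega> *\<^sub>R torus_generator z"

lemma cubic_part_eq:
  "cubic_part z = ((of_real a + \<i> * of_real \<omega>) / (2 * of_real \<omega>) * nonlinearity z 1,
     - (of_real a - \<i> * of_real \<omega>) / (2 * of_real \<omega>) * nonlinearity z 1)"
  by (simp add: cubic_part_def velocity_def torus_generator_def scaleR_conv_of_real)
    (simp add: minus_divide_left algebra_simps)

lemma norm_cubic_part: "\<exists>C\<ge>0. \<forall>z. norm (cubic_part z) \<le> C * norm (nonlinearity z 1)"
proof -
  let ?p = "(of_real a + \<i> * of_real \<omega>) / (2 * of_real \<omega>) :: complex"
  let ?q = "- (of_real a - \<i> * of_real \<omega>) / (2 * of_real \<omega>) :: complex"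
  have "norm (cubic_part z) \<le> (norm ?p + norm ?q) * norm (nonlinearity z 1)" for z
    using norm_Pair_le[of "?p * nonlinearity z 1" "?q * nonlinearity z 1"]
    unfolding cubic_part_eq norm_mult distrib_right .
  then show ?thesis by (intro exI[of _ "norm ?p + norm ?q"]) simp
qed

lemma fc_family_linear:
  assumes fam: "smooth_family \<rho> q Dq" and z: "z \<in> ball 0 \<rho>"
  shows "fc (\<lambda>x. of_real (Dq z x (\<omega> *\<^sub>R h + k))) m
       = of_real \<omega> * fc (\<lambda>x. of_real (Dq z x h)) m + fc (\<lambda>x. of_real (Dq z x k)) m"
proof -
  have lin: "linear (Dq z x)" for x
    using fam z has_derivative_linear unfolding smooth_family_def by metis
  have cont: "continuous_on {0..2 * pi} (\<lambda>x. Dq z x h)" for h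
    using z by (intro smooth_family_continuous_Du[OF fam] continuous_intros)
  have "(\<lambda>x. complex_of_real (Dq z x (\<omega> *\<^sub>R h + k)))
      = (\<lambda>x. of_real \<omega> * of_real (Dq z x h) + of_real (Dq z x k))"
    by (simp add: linear_add[OF lin] linear_cmul[OF lin])
  then show ?thesis
    by (simp add: fc_add fc_cmult cont continuous_on_of_real continuous_on_mult)
qed

lemma vanishes_family_cubic_part:
  assumes fam: "smooth_family \<rho> q Dq"
  shows "vanishes 3 (\<lambda>z x. fc (\<lambda>x. of_real (Dq z x (cubic_part z))) m)"
proof -
  obtain K where K: "\<And>z x h. norm z \<le> \<rho> / 2 \<Longrightarrow> x \<in> {0..2 * pi} \<Longrightarrow> \<bar>Dq z x h\<bar> \<le> K * norm h"
    using smooth_family_Du_bound[OF fam \<rho>_pos] by metis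
  obtain C where C: "C \<ge> 0" "\<And>z. norm (cubic_part z) \<le> C * norm (nonlinearity z 1)"
    using norm_cubic_part by blast
  show ?thesis
  proof (rule vanishes_dominated[OF vanishes_nonlinearity_1])
    fix z :: amplitudes and x' :: real assume z: "norm z < \<rho> / 2"
    show "norm (fc (\<lambda>x. of_real (Dq z x (cubic_part z))) m) \<le> \<bar>K\<bar> * C * norm (nonlinearity z 1)"
    proof (rule fc_bound)
      show "continuous_on {0..2 * pi} (\<lambda>x. complex_of_real (Dq z x (cubic_part z)))"
        using z \<rho>_pos by (intro continuous_intros smooth_family_continuous_Du[OF fam]) auto
      fix x assume x: "x \<in> {0..2 * pi}"
      have "norm (complex_of_real (Dq z x (cubic_part z))) \<le> K * norm (cubic_part z)"
        using K[of z x "cubic_part z"] z x by simp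
      also have "\<dots> \<le> \<bar>K\<bar> * (C * norm (nonlinearity z 1))"
        using C by (intro mult_mono) auto
      finally show "norm (complex_of_real (Dq z x (cubic_part z))) \<le> \<bar>K\<bar> * C * norm (nonlinearity z 1)"
        by (simp add: mult.assoc)
    qed
  qed (use \<rho>_pos in simp)
qed

text \<open>The determinant of \<open>i n \<omega> - M\<^sub>2\<close> at criticality.\<close>

definition \<Delta> :: "int \<Rightarrow> complex" where
  "\<Delta> n = (\<i> * of_int n * of_real \<omega> + 16 * of_real a) * (\<i> * of_int n * of_real \<omega> - 4 * of_real a + 12)
     + 4 * (of_real c)\<^sup>2"

text \<open>The second mode of the manifold satisfies, along the linear flow and up to third order, the linear
equation with matrix \<open>M\<^sub>2\<close> forced by \<open>i w\<^sup>2\<close>.  Its Fourier component of frequency \<open>n\<close> in the phase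
\<open>s\<close> satisfies an algebraic system of size two; eliminating the \<open>v\<close> component leaves the determinant
\<open>\<Delta> n\<close> of \<open>i n \<omega> - M\<^sub>2\<close>.\<close>

lemma second_mode_average:
  "vanishes 3 (\<lambda>z x. \<Delta> n * average (\<lambda>z. u_hat z 2) z n + 2 * average (\<lambda>z. (w z)\<^sup>2) z n)"
proof -
  define P where "P z = of_real \<omega> * Du2 z (torus_generator z) - (2 * \<i> * v_hat z 2 - 16 * of_real a * u_hat z 2)" for z
  define Q where "Q z = of_real \<omega> * Dv2 z (torus_generator z)
      - (2 * \<i> * ((of_real c)\<^sup>2 * u_hat z 2 + 1 / 2 * (w z)\<^sup>2) + (4 * of_real a - 12) * v_hat z 2)" for z
  have vel: "velocity z = \<omega> *\<^sub>R torus_generator z + cubic_part z" for z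
    by (simp add: cubic_part_def)
  have eq: "P z = - Du2 z (cubic_part z)" "Q z = 2 * \<i> * (nonlinearity z 2 - (w z)\<^sup>2 / 2) - Dv2 z (cubic_part z)"
    if z: "z \<in> ball 0 \<rho>" for z
  proof -
    have sys: "system_at z (velocity z)" using manifold_solution[OF z] by metis
    show "P z = - Du2 z (cubic_part z)"
      using system_at_modes(1)[OF z sys, of 2]
      by (simp add: vel fc_family_linear[OF smooth_families(1) z] P_def algebra_simps)
    show "Q z = 2 * \<i> * (nonlinearity z 2 - (w z)\<^sup>2 / 2) - Dv2 z (cubic_part z)"
      using system_at_modes(2)[OF z sys, of 2]
      by (simp add: vel fc_family_linear[OF smooth_families(2) z] Q_def algebra_simps)
  qed
  have "vanishes 3 (\<lambda>z x. P z)"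
    by (rule vanishes_cong_ball[OF vanishes_uminus[OF vanishes_family_cubic_part[OF smooth_families(1)]]]) (rule eq)
  moreover have "vanishes 3 (\<lambda>z x. Q z)"
    by (rule vanishes_cong_ball[OF vanishes_diff[OF vanishes_cmult[OF nonlinearity_2]
          vanishes_family_cubic_part[OF smooth_families(2)]]]) (rule eq)
  moreover have w: "continuous_on {0..2 * pi} (\<lambda>s. w (torus_flow s z))" for z
    unfolding w_torus_flow by (intro continuous_intros)
  note cont = continuous_hat continuous_D2 w
  moreover have "continuous_on {0..2 * pi} (\<lambda>s. P (torus_flow s z))"
      "continuous_on {0..2 * pi} (\<lambda>s. Q (torus_flow s z))" if "z \<in> ball 0 \<rho>" for z
    unfolding P_def Q_def using that by (intro continuous_intros cont; assumption)+
  ultimately have van: "vanishes 3 (\<lambda>z x. average P z n)" "vanishes 3 (\<lambda>z x. average Q z n)"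
    by (auto intro!: vanishes_average)
  have "\<Delta> n * average (\<lambda>z. u_hat z 2) z n + 2 * average (\<lambda>z. (w z)\<^sup>2) z n
      = (\<i> * of_int n * of_real \<omega> - 4 * of_real a + 12) * average P z n + 2 * \<i> * average Q z n"
    if z: "z \<in> ball 0 \<rho>" for z
  proof -
    note c = continuous_hat[OF z] continuous_D2[OF z] w continuous_intros
    have eP: "average P z n = of_real \<omega> * average (\<lambda>z. Du2 z (torus_generator z)) z n
        - (2 * \<i> * average (\<lambda>z. v_hat z 2) z n - 16 * of_real a * average (\<lambda>z. u_hat z 2) z n)"
      unfolding P_def by (simp add: fc_diff fc_cmult c z)
    have eQ: "average Q z n = of_real \<omega> * average (\<lambda>z. Dv2 z (torus_generator z)) z n
      - (2 * \<i> * ((of_real c)\<^sup>2 * average (\<lambda>z. u_hat z 2) z n + 1 / 2 * average (\<lambda>z. (w z)\<^sup>2) z n)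
         + (4 * of_real a - 12) * average (\<lambda>z. v_hat z 2) z n)"
      unfolding Q_def by (simp add: fc_add fc_diff fc_cmult fc_divide c z)
    show ?thesis
      unfolding eP eQ average_D2[OF z] \<Delta>_def by (simp add: algebra_simps)
  qed
  then show ?thesis
    by (rule vanishes_cong_ball[OF vanishes_add[OF vanishes_cmult[OF van(1)] vanishes_cmult[OF van(2)]]])
qed

section \<open>The near-identity change of coordinates\<close>

abbreviation \<theta> where "\<theta> \<equiv> \<Theta> (a + 1)"

definition D\<theta> :: "amplitudes \<Rightarrow> amplitudes \<Rightarrow> amplitudes" where
  "D\<theta> z h = frechet_derivative (\<lambda>(\<delta>, z). \<Theta> \<delta> z) (at (a + 1, z)) (0, h)"

lemma class_C_\<theta>: "class_C 5 (ball (a + 1) \<rho> \<times> ball 0 \<rho>) (\<lambda>(\<delta>, z). \<Theta> \<delta> z)"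
  using near_id unfolding near_identity_equivariant_def by blast

lemma \<theta>_derivative:
  assumes "z \<in> ball 0 \<rho>"
  shows "(\<theta> has_derivative D\<theta> z) (at z)"
proof -
  have "((\<lambda>(\<delta>, z). \<Theta> \<delta> z) has_derivative frechet_derivative (\<lambda>(\<delta>, z). \<Theta> \<delta> z) (at (a + 1, z))) (at (a + 1, z))"
    using assms \<rho>_pos by (intro class_C_differentiable[OF class_C_mono[OF class_C_\<theta>, of "Suc 0"]]) auto
  moreover have "((\<lambda>z. (a + 1, z)) has_derivative (\<lambda>h. (0, h))) (at z)"
    by (intro derivative_eq_intros) auto
  ultimately show ?thesis
    unfolding D\<theta>_def[abs_def] using has_derivative_compose by fastforce
qed

lemma continuous_D\<theta>:
  assumes "continuous_on S f" "continuous_on S g" "\<And>s. s \<in> S \<Longrightarrow> f s \<in> ball 0 \<rho>"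
  shows "continuous_on S (\<lambda>s. D\<theta> (f s) (g s))"
proof -
  have "class_C (Suc 0) (ball (a + 1) \<rho> \<times> ball 0 \<rho>) (\<lambda>(\<delta>, z). \<Theta> \<delta> z)"
    by (rule class_C_mono[OF class_C_\<theta>]) simp
  from class_C_continuous_derivative[OF this]
  have "continuous_on S ((\<lambda>(p, h). frechet_derivative (\<lambda>(\<delta>, z). \<Theta> \<delta> z) (at p) h) \<circ> (\<lambda>s. ((a + 1, f s), (0, g s))))"
    using assms \<rho>_pos by (intro continuous_on_compose continuous_intros) (auto elim!: continuous_on_subset)
  then show ?thesis by (simp add: o_def D\<theta>_def)
qed

lemma \<theta>_near_identity:
  obtains K where "K \<ge> 0" "\<And>z. z \<in> ball 0 \<rho> \<Longrightarrow> norm (\<theta> z - z) \<le> K * norm z ^ 3"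
proof -
  obtain K where "\<And>z. z \<in> ball 0 \<rho> \<Longrightarrow> norm (\<theta> z - z) \<le> K * norm z ^ 3"
    using near_id \<rho>_pos unfolding near_identity_equivariant_def by (metis centre_in_ball)
  moreover have "K * norm z ^ 3 \<le> \<bar>K\<bar> * norm z ^ 3" for z :: amplitudes
    by (intro mult_right_mono) auto
  ultimately show thesis
    using that[of "\<bar>K\<bar>"] order_trans by fastforce
qed

lemma \<theta>_0: "\<theta> 0 = 0"
proof -
  obtain K where "norm (\<theta> 0 - 0) \<le> K * norm (0::amplitudes) ^ 3"
    using \<theta>_near_identity \<rho>_pos by (metis centre_in_ball)
  then show ?thesis by simp
qed

lemma D\<theta>_0: "D\<theta> 0 h = h"
proof -
  obtain K where K: "K \<ge> 0" "\<And>z. z \<in> ball 0 \<rho> \<Longrightarrow> norm (\<theta> z - z) \<le> K * norm z ^ 3"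
    using \<theta>_near_identity by blast
  have "(\<theta> has_derivative (\<lambda>h. h)) (at 0)"
    unfolding has_derivative_at_alt
  proof (intro conjI allI impI)
    fix e :: real assume e: "e > 0"
    define d where "d = min \<rho> (min 1 (e / (K + 1)))"
    have d: "d > 0" using e K \<rho>_pos by (simp add: d_def)
    have "norm (\<theta> z - \<theta> 0 - (z - 0)) \<le> e * norm (z - 0)" if z: "norm (z - 0) < d" for z
    proof -
      have zb: "norm z < \<rho>" "norm z \<le> 1" "norm z \<le> e / (K + 1)" using z by (auto simp: d_def)
      have "norm (\<theta> z - z) \<le> K * norm z ^ 3" using K(2) zb(1) by simp
      also have "\<dots> \<le> K * (norm z * norm z)"
        using K zb(2) by (intro mult_left_mono) (auto simp: power3_eq_cube mult_left_le)
      also have "\<dots> = (K * norm z) * norm z" by simp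
      also have "\<dots> \<le> ((K + 1) * (e / (K + 1))) * norm z"
        using K zb by (intro mult_right_mono mult_mono) auto
      also have "\<dots> = e * norm z" using K by simp
      finally show ?thesis by (simp add: \<theta>_0)
    qed
    with d show "\<exists>d>0. \<forall>y. norm (y - 0) < d \<longrightarrow> norm (\<theta> y - \<theta> 0 - (y - 0)) \<le> e * norm (y - 0)" by blast
  qed (rule bounded_linear_ident)
  then show ?thesis using has_derivative_unique[OF \<theta>_derivative] \<rho>_pos by (metis centre_in_ball)
qed

text \<open>The cubic bound forces the derivative at the origin to be the identity; smoothness then makes the
deviation from the identity of first order in \<open>z\<close>.\<close>

lemma D\<theta>_near_identity:
  "\<exists>K\<ge>0. \<exists>r>0. \<forall>z h. norm z < r \<longrightarrow> norm (D\<theta> z h - h) \<le> K * norm z * norm h"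
proof -
  let ?F = "\<lambda>(\<delta>, z). \<Theta> \<delta> z" and ?S = "ball (a + 1) \<rho> \<times> ball (0::amplitudes) \<rho>"
  have C2: "class_C 2 ?S ?F" using class_C_mono[OF class_C_\<theta>, of 2] by simp
  have "open ?S" "(a + 1, 0) \<in> ?S" using \<rho>_pos by (auto intro!: open_Times)
  then obtain K r where r: "r > 0" and K: "\<And>p h. p \<in> ball (a + 1, 0) r \<Longrightarrow>
      norm (frechet_derivative ?F (at p) h - frechet_derivative ?F (at (a + 1, 0)) h)
        \<le> K * norm (p - (a + 1, 0)) * norm h"
    using class_C_derivative_estimate[OF C2] by blast
  have "norm (D\<theta> z h - h) \<le> \<bar>K\<bar> * norm z * norm h" if z: "norm z < r" for z h
  proof -
    have n: "norm ((0::real), y) = norm y" for y :: amplitudes by (simp add: norm_prod_def)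
    have "norm (D\<theta> z h - D\<theta> 0 h) \<le> K * norm z * norm h"
      using K[of "(a + 1, z)" "(0, h)"] z
      by (simp add: D\<theta>_def dist_norm n norm_minus_commute[of _ z] del: norm_Pair)
        (simp add: norm_prod_def)?
    also have "\<dots> \<le> \<bar>K\<bar> * norm z * norm h" by (intro mult_right_mono) auto
    finally show ?thesis by (simp add: D\<theta>_0)
  qed
  then show ?thesis using r by (intro exI[of _ "\<bar>K\<bar>"]) auto
qed

definition cubic_term :: "amplitudes \<Rightarrow> complex" where
  "cubic_term z = fst z * (\<zeta> * of_real ((cmod (fst z))\<^sup>2) + \<xi> * of_real ((cmod (snd z))\<^sup>2))"

lemma cubic_term_eq:
  "cubic_term z = \<zeta> * (fst z * fst z * cnj (fst z)) + \<xi> * (fst z * snd z * cnj (snd z))"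
  unfolding cubic_term_def complex_norm_square by (simp add: algebra_simps)

text \<open>At \<open>\<delta> = \<delta>\<^sub>c\<close> the first remainder term of the normal form is zero.\<close>

lemma normal_form_equation:
  "\<exists>K. \<forall>z\<in>ball 0 \<rho>. norm (fst (D\<theta> z (velocity z)) - \<i> * of_real \<omega> * fst (\<theta> z) - cubic_term (\<theta> z))
       \<le> K * norm (\<theta> z) ^ 5"
proof -
  let ?N = "cubic_field (\<i> * of_real \<omega>) (- \<i> * of_real \<omega>) \<zeta> \<xi>"
  have "a + 1 \<in> ball (a + 1) \<rho>" using \<rho>_pos by simp
  moreover obtain K where "\<forall>\<delta>\<in>ball (a + 1) \<rho>. \<forall>T y. open T \<and> reduced_solution a c \<eta> \<rho> U V \<delta> T y \<longrightarrow>
      (\<forall>t\<in>T. \<exists>R. ((\<lambda>s. \<Theta> \<delta> (y s)) has_vector_derivative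
            cubic_field (beta1 a c \<delta>) (beta2 a c \<delta>) \<zeta> \<xi> (\<Theta> \<delta> (y t)) + R) (at t) \<and>
         norm R \<le> K * (\<bar>\<delta> - (a + 1)\<bar> * norm (\<Theta> \<delta> (y t)) ^ 3 + norm (\<Theta> \<delta> (y t)) ^ 5))"
    using normal_form unfolding brings_into_normal_form_def ..
  ultimately have "\<forall>T y. open T \<and> reduced_solution a c \<eta> \<rho> U V (a + 1) T y \<longrightarrow>
      (\<forall>t\<in>T. \<exists>R. ((\<lambda>s. \<theta> (y s)) has_vector_derivative
            cubic_field (beta1 a c (a + 1)) (beta2 a c (a + 1)) \<zeta> \<xi> (\<theta> (y t)) + R) (at t) \<and>
         norm R \<le> K * (\<bar>(a + 1) - (a + 1)\<bar> * norm (\<theta> (y t)) ^ 3 + norm (\<theta> (y t)) ^ 5))"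
    by (rule bspec[rotated])
  then have K: "\<exists>R. ((\<lambda>s. \<theta> (y s)) has_vector_derivative ?N (\<theta> (y t)) + R) (at t) \<and>
         norm R \<le> K * (\<bar>(a + 1) - (a + 1)\<bar> * norm (\<theta> (y t)) ^ 3 + norm (\<theta> (y t)) ^ 5)"
    if "open T" "reduced_solution a c \<eta> \<rho> U V (a + 1) T y" "t \<in> T" for T y t
    using that unfolding beta_critical by blast
  show ?thesis
  proof (intro exI ballI)
    fix z :: amplitudes assume z: "z \<in> ball 0 \<rho>"
    obtain e y where y: "e > 0" "y 0 = z" "reduced_solution a c \<eta> \<rho> U V (a + 1) {-e<..<e} y"
      "(y has_vector_derivative velocity z) (at 0)"
      using manifold_solution[OF z] by metis
    obtain R where R: "((\<lambda>s. \<theta> (y s)) has_vector_derivative ?N (\<theta> z) + R) (at 0)"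
        "norm R \<le> K * norm (\<theta> z) ^ 5"
      using K[OF open_greaterThanLessThan y(3), of 0] y(1,2) by auto
    have "((\<lambda>s. \<theta> (y s)) has_vector_derivative D\<theta> z (velocity z)) (at 0)"
      using vector_derivative_diff_chain_within[OF y(4), of \<theta> "D\<theta> z"] \<theta>_derivative[OF z] y(2)
      by (simp add: o_def has_derivative_at_withinI)
    then have "D\<theta> z (velocity z) = ?N (\<theta> z) + R"
      using R(1) vector_derivative_unique_at by blast
    then have "fst (D\<theta> z (velocity z)) - \<i> * of_real \<omega> * fst (\<theta> z) - cubic_term (\<theta> z) = fst R"
      by (simp add: cubic_field_def cubic_term_def split_beta)
    then show "norm (fst (D\<theta> z (velocity z)) - \<i> * of_real \<omega> * fst (\<theta> z) - cubic_term (\<theta> z))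
       \<le> K * norm (\<theta> z) ^ 5"
      using norm_fst_le[of "fst R" "snd R"] R(2) by simp
  qed
qed

lemma vanishes_\<theta>: "vanishes 3 (\<lambda>z x. fst (\<theta> z) - fst z)" "vanishes 3 (\<lambda>z x. snd (\<theta> z) - snd z)"
proof -
  obtain K where K: "K \<ge> 0" "\<And>z. z \<in> ball 0 \<rho> \<Longrightarrow> norm (\<theta> z - z) \<le> K * norm z ^ 3"
    using \<theta>_near_identity by blast
  have "norm (fst (\<theta> z) - fst z) \<le> K * norm z ^ 3" "norm (snd (\<theta> z) - snd z) \<le> K * norm z ^ 3"
    if "norm z < \<rho>" for z
    using K(2)[of z] that order_trans[OF norm_fst_snd_le(1)[of "\<theta> z - z"]]
      order_trans[OF norm_fst_snd_le(2)[of "\<theta> z - z"]] by auto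
  then show "vanishes 3 (\<lambda>z x. fst (\<theta> z) - fst z)" "vanishes 3 (\<lambda>z x. snd (\<theta> z) - snd z)"
    using \<rho>_pos by (auto intro!: vanishesI[of \<rho>])
qed

lemma vanishes_\<theta>_1: "vanishes 1 (\<lambda>z x. fst (\<theta> z))" "vanishes 1 (\<lambda>z x. snd (\<theta> z))"
  using vanishes_add[OF vanishes_mono[OF vanishes_\<theta>(1), of 1] vanishes_fst]
    vanishes_add[OF vanishes_mono[OF vanishes_\<theta>(2), of 1] vanishes_snd] by simp_all

lemma vanishes_cubic_term_\<theta>: "vanishes 5 (\<lambda>z x. cubic_term (\<theta> z) - cubic_term z)"
proof -
  have c: "vanishes 3 (\<lambda>z x. cnj (fst (\<theta> z)) - cnj (fst z))" "vanishes 3 (\<lambda>z x. cnj (snd (\<theta> z)) - cnj (snd z))"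
    using vanishes_cnj[OF vanishes_\<theta>(1)] vanishes_cnj[OF vanishes_\<theta>(2)] by simp_all
  note v = vanishes_\<theta> vanishes_\<theta>_1 vanishes_fst vanishes_snd c vanishes_cnj
  have "vanishes 5 (\<lambda>z x. fst (\<theta> z) * fst (\<theta> z) * cnj (fst (\<theta> z)) - fst z * fst z * cnj (fst z))"
    "vanishes 5 (\<lambda>z x. fst (\<theta> z) * snd (\<theta> z) * cnj (snd (\<theta> z)) - fst z * snd z * cnj (snd z))"
    by (intro vanishes_triple_product_diff v)+
  from vanishes_add[OF vanishes_cmult[OF this(1), of \<zeta>] vanishes_cmult[OF this(2), of \<xi>]]
  show ?thesis by (simp add: cubic_term_eq algebra_simps)
qed

lemma vanishes_normal_form_remainder:
  "vanishes 5 (\<lambda>z x. fst (D\<theta> z (velocity z)) - \<i> * of_real \<omega> * fst (\<theta> z) - cubic_term (\<theta> z))"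
proof -
  obtain K where K: "\<And>z. z \<in> ball 0 \<rho> \<Longrightarrow> norm (fst (D\<theta> z (velocity z)) - \<i> * of_real \<omega> * fst (\<theta> z) - cubic_term (\<theta> z))
       \<le> K * norm (\<theta> z) ^ 5"
    using normal_form_equation by blast
  have "vanishes 1 (\<lambda>z x. of_real (norm (\<theta> z)))"
  proof (rule vanishes_dominated)
    show "vanishes 1 (\<lambda>z x. of_real (norm (fst (\<theta> z)) + norm (snd (\<theta> z))))"
      using vanishes_add[of 1 "\<lambda>z x. of_real (norm (fst (\<theta> z)))" "\<lambda>z x. of_real (norm (snd (\<theta> z)))"] vanishes_\<theta>_1
      by (simp add: vanishes_def)
    show "norm (complex_of_real (norm (\<theta> z))) \<le> 1 * norm (complex_of_real (norm (fst (\<theta> z)) + norm (snd (\<theta> z))))" for z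
      using norm_Pair_le[of "fst (\<theta> z)" "snd (\<theta> z)"] by (simp del: of_real_add)
  qed (rule zero_less_one)
  then have "vanishes (1 + 1 + 1 + 1 + 1) (\<lambda>z x. of_real (norm (\<theta> z)) * of_real (norm (\<theta> z)) * of_real (norm (\<theta> z))
      * of_real (norm (\<theta> z)) * of_real (norm (\<theta> z)))"
    by (intro vanishes_mult)
  then have "vanishes 5 (\<lambda>z x. of_real (norm (\<theta> z)) ^ 5)"
    by (simp add: eval_nat_numeral mult.assoc)
  then show ?thesis
    by (rule vanishes_dominated[OF _ \<rho>_pos]) (use K in \<open>simp add: norm_power\<close>)
qed

lemma vanishes_D\<theta>_cubic_part:
  "vanishes 4 (\<lambda>z x. fst (D\<theta> z (cubic_part z)) - fst (cubic_part z))"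
proof -
  obtain K r where K: "r > 0" "K \<ge> 0" "\<And>z h. norm z < r \<Longrightarrow> norm (D\<theta> z h - h) \<le> K * norm z * norm h"
    using D\<theta>_near_identity by blast
  obtain C where C: "C \<ge> 0" "\<And>z. norm (cubic_part z) \<le> C * norm (nonlinearity z 1)"
    using norm_cubic_part by blast
  have "vanishes (1 + 3) (\<lambda>z x. of_real (norm z) * nonlinearity z 1)"
    by (intro vanishes_mult vanishes_norm vanishes_nonlinearity_1)
  then have "vanishes 4 (\<lambda>z x. of_real (norm z) * nonlinearity z 1)" by simp
  then show ?thesis
  proof (rule vanishes_dominated)
    fix z :: amplitudes assume z: "norm z < r"
    let ?d = "D\<theta> z (cubic_part z) - cubic_part z"
    have "norm (fst ?d) \<le> norm ?d" by (rule norm_fst_snd_le)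
    also have "\<dots> \<le> K * norm z * norm (cubic_part z)" using K z by blast
    also have "\<dots> \<le> K * norm z * (C * norm (nonlinearity z 1))"
      using K C by (intro mult_left_mono) auto
    finally show "norm (fst (D\<theta> z (cubic_part z)) - fst (cubic_part z))
      \<le> K * C * norm (of_real (norm z) * nonlinearity z 1)"
      by (simp add: norm_mult mult_ac)
  qed (rule K)
qed

section \<open>The coefficients\<close>

lemma cubic_term_torus_flow: "cubic_term (torus_flow s z) = cubic_term z * cis (of_int 1 * s)"
  by (simp add: cubic_term_def torus_flow_def norm_mult)

text \<open>For the linear vector field \<open>L\<close>, the first component of \<open>D\<theta> L - L \<theta>\<close> along the flow, multiplied by
\<open>e\<^sup>-\<^sup>i\<^sup>s\<close>, is \<open>\<omega>\<close> times the derivative of the periodic function \<open>e\<^sup>-\<^sup>i\<^sup>s \<theta>\<^sub>1\<close>, so its average is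
exactly zero, whatever the cubic terms of \<open>\<theta>\<close> are.  On the other hand the normal form equation identifies
it, up to fourth order, with the cubic normal form minus the cubic part of the reduced vector field;
the former commutes with the flow and is its own average.\<close>

lemma averaged_identity:
  "vanishes 4 (\<lambda>z x. (of_real a + \<i> * of_real \<omega>) / (2 * of_real \<omega>) *
      (average (\<lambda>z. cnj (w z) * u_hat z 2) z 1 + of_real \<eta> * average (\<lambda>z. (w z)\<^sup>2 * cnj (w z)) z 1)
      - cubic_term z)"
proof -
  let ?k = "(of_real a + \<i> * of_real \<omega>) / (2 * of_real \<omega>) :: complex"
  \<comment> \<open>The average of \<open>H\<close> is zero; \<open>G\<close> compares \<open>H\<close> with the explicit terms of order three.\<close>
  define H where "H z = of_real \<omega> * fst (D\<theta> z (torus_generator z)) - \<i> * of_real \<omega> * fst (\<theta> z)" for z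
  define G where "G z = H z - cubic_term z + ?k * (cnj (w z) * u_hat z 2 + of_real \<eta> * ((w z)\<^sup>2 * cnj (w z)))" for z
  have G: "G z = (fst (D\<theta> z (velocity z)) - \<i> * of_real \<omega> * fst (\<theta> z) - cubic_term (\<theta> z))
      + (cubic_term (\<theta> z) - cubic_term z) - (fst (D\<theta> z (cubic_part z)) - fst (cubic_part z))
      - ?k * (nonlinearity z 1 - (cnj (w z) * u_hat z 2 + of_real \<eta> * ((w z)\<^sup>2 * cnj (w z))))"
    if z: "z \<in> ball 0 \<rho>" for z
  proof -
    have lin: "linear (D\<theta> z)" using \<theta>_derivative[OF z] by (rule has_derivative_linear)
    have "velocity z = \<omega> *\<^sub>R torus_generator z + cubic_part z" by (simp add: cubic_part_def)
    then have "fst (D\<theta> z (velocity z)) = of_real \<omega> * fst (D\<theta> z (torus_generator z)) + fst (D\<theta> z (cubic_part z))"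
      by (simp add: linear_add[OF lin] linear_cmul[OF lin] scaleR_conv_of_real)
    moreover have "fst (cubic_part z) = ?k * nonlinearity z 1" by (simp add: cubic_part_eq)
    ultimately show ?thesis
      unfolding G_def H_def right_diff_distrib by simp
  qed
  have "vanishes 4 (\<lambda>z x. (fst (D\<theta> z (velocity z)) - \<i> * of_real \<omega> * fst (\<theta> z) - cubic_term (\<theta> z))
      + (cubic_term (\<theta> z) - cubic_term z) - (fst (D\<theta> z (cubic_part z)) - fst (cubic_part z))
      - ?k * (nonlinearity z 1 - (cnj (w z) * u_hat z 2 + of_real \<eta> * ((w z)\<^sup>2 * cnj (w z)))))"
    by (intro vanishes_diff[OF vanishes_diff[OF vanishes_add]] vanishes_cmult nonlinearity_1
        vanishes_D\<theta>_cubic_part vanishes_mono[OF vanishes_cubic_term_\<theta>]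
        vanishes_mono[OF vanishes_normal_form_remainder]) simp_all
  then have "vanishes 4 (\<lambda>z x. G z)"
    by (rule vanishes_cong_ball) (rule G)
  moreover have w: "continuous_on {0..2 * pi} (\<lambda>s. w (torus_flow s z))" for z
    unfolding w_torus_flow by (intro continuous_intros)
  have \<theta>_vd: "((\<lambda>s. \<theta> (torus_flow s z)) has_vector_derivative
      D\<theta> (torus_flow s z) (torus_generator (torus_flow s z))) (at s within {0..2 * pi})"
    if "z \<in> ball 0 \<rho>" for s z
    using vector_derivative_diff_chain_within[OF torus_flow_derivative
        has_derivative_at_withinI[OF \<theta>_derivative[OF torus_flow_ball[OF that]]]]
    by (simp add: o_def)
  have c\<theta>: "continuous_on {0..2 * pi} (\<lambda>s. \<theta> (torus_flow s z))"
      "continuous_on {0..2 * pi} (\<lambda>s. D\<theta> (torus_flow s z) (torus_generator (torus_flow s z)))"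
    if "z \<in> ball 0 \<rho>" for z
    using that by (auto intro!: continuous_on_vector_derivative[OF \<theta>_vd] continuous_D\<theta> continuous_torus_flow)
  have cH: "continuous_on {0..2 * pi} (\<lambda>s. H (torus_flow s z))" if "z \<in> ball 0 \<rho>" for z
    unfolding H_def using that by (intro continuous_intros c\<theta>)
  have cc: "continuous_on {0..2 * pi} (\<lambda>s. cubic_term (torus_flow s z))" for z
    unfolding cubic_term_torus_flow by (intro continuous_intros)
  have cw: "continuous_on {0..2 * pi} (\<lambda>s. cnj (w (torus_flow s z)) * u_hat (torus_flow s z) 2)"
    "continuous_on {0..2 * pi} (\<lambda>s. (w (torus_flow s z))\<^sup>2 * cnj (w (torus_flow s z)))" if "z \<in> ball 0 \<rho>" for z
    using that by (intro continuous_intros w continuous_hat(1); assumption)+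
  have cG: "continuous_on {0..2 * pi} (\<lambda>s. G (torus_flow s z))" if "z \<in> ball 0 \<rho>" for z
    unfolding G_def using that by (intro continuous_intros cH cc cw)
  ultimately have "vanishes 4 (\<lambda>z x. average G z 1)" by (intro vanishes_average)
  then show ?thesis
  proof (rule vanishes_cong_ball)
    fix z :: amplitudes assume z: "z \<in> ball 0 \<rho>"
    have "average (\<lambda>z. fst (D\<theta> z (torus_generator z))) z 1 = \<i> * average (\<lambda>z. fst (\<theta> z)) z 1"
      using fc_derivative[of "\<lambda>s. fst (\<theta> (torus_flow s z))" _ 1, OF
         bounded_linear.has_vector_derivative[OF bounded_linear_fst \<theta>_vd[OF z]]]
      by (simp add: torus_flow_2pi)
    moreover have "average H z 1 = of_real \<omega> * average (\<lambda>z. fst (D\<theta> z (torus_generator z))) z 1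
        - \<i> * of_real \<omega> * average (\<lambda>z. fst (\<theta> z)) z 1"
      unfolding H_def by (subst fc_diff; (intro continuous_intros c\<theta> z)?) (simp only: fc_cmult)
    ultimately have "average H z 1 = 0" by simp
    moreover have "average cubic_term z 1 = cubic_term z"
      unfolding cubic_term_torus_flow fc_monomial by simp
    moreover have "average G z 1 = average H z 1 - average cubic_term z 1
       + ?k * (average (\<lambda>z. cnj (w z) * u_hat z 2) z 1 + of_real \<eta> * average (\<lambda>z. (w z)\<^sup>2 * cnj (w z)) z 1)"
    proof -
      note 1 = continuous_on_mult_left[OF cw(2)[OF z], of "of_real \<eta>"]
      note 2 = continuous_on_add[OF cw(1)[OF z] 1]
      show ?thesis
        unfolding G_def fc_add[OF continuous_on_diff[OF cH[OF z] cc] continuous_on_mult_left[OF 2]]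
          fc_diff[OF cH[OF z] cc] fc_cmult fc_add[OF cw(1)[OF z] 1] ..
    qed
    ultimately show "?k * (average (\<lambda>z. cnj (w z) * u_hat z 2) z 1
        + of_real \<eta> * average (\<lambda>z. (w z)\<^sup>2 * cnj (w z)) z 1) - cubic_term z = average G z 1"
      by simp
  qed
qed

lemma average_w_square: "average (\<lambda>z. (w z)\<^sup>2) z n =
   (if n = 2 then (\<kappa> * fst z)\<^sup>2 else 0) + (if n = 0 then - 2 * \<kappa> * cnj \<kappa> * fst z * snd z else 0)
     + (if n = -2 then (cnj \<kappa> * snd z)\<^sup>2 else 0)"
  unfolding w_torus_flow cis_square_identity fc_trig_poly by simp

lemma average_w_cube: "average (\<lambda>z. (w z)\<^sup>2 * cnj (w z)) z 1 =
   \<kappa>\<^sup>2 * cnj \<kappa> * (fst z * fst z * cnj (fst z)) + 2 * \<kappa>\<^sup>2 * cnj \<kappa> * (fst z * snd z * cnj (snd z))"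
  unfolding w_torus_flow(2) unfolding w_torus_flow(1) cis_cube_identity fc_trig_poly by (simp add: power2_eq_square algebra_simps)

text \<open>Only the phase frequencies \<open>0\<close> and \<open>2\<close> of the second harmonic can resonate with the critical mode.\<close>

lemma average_w_u_hat:
  assumes z: "z \<in> ball 0 \<rho>"
  shows "average (\<lambda>z. cnj (w z) * u_hat z 2) z 1 =
    - \<kappa> * cnj (snd z) * average (\<lambda>z. u_hat z 2) z 0 + cnj \<kappa> * cnj (fst z) * average (\<lambda>z. u_hat z 2) z 2"
proof -
  have eq: "(\<lambda>s. cnj (w (torus_flow s z)) * u_hat (torus_flow s z) 2)
     = (\<lambda>s. (- \<kappa> * cnj (snd z)) * (cis (of_int 1 * s) * u_hat (torus_flow s z) 2)
         + (cnj \<kappa> * cnj (fst z)) * (cis (of_int (-1) * s) * u_hat (torus_flow s z) 2))"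
    unfolding w_torus_flow(2) by (simp add: algebra_simps)
  have c: "continuous_on {0..2 * pi} (\<lambda>s. k * (cis (of_int m * s) * u_hat (torus_flow s z) 2))" for k m
    using z by (intro continuous_intros continuous_hat)
  show ?thesis
    unfolding eq fc_add[OF c c] fc_cmult fc_cis_mult by simp
qed

text \<open>The hypothesis on \<open>c\<close> enters through \<open>(a + 1)\<^sup>3 - 108 (a - 3) = (a - 5)\<^sup>2 (a + 13)\<close>.\<close>

lemma nonresonance_pos: "c\<^sup>2 - 16 * a * (a - 3) > 0"
proof -
  have "4 * a * (a + 1) ^ 3 / 27 - 16 * a * (a - 3) = 4 * a * ((a - 5)\<^sup>2 * (a + 13)) / 27"
    by (simp add: power2_eq_square power3_eq_cube field_simps)
  also have "\<dots> \<ge> 0" using a_pos by simp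
  finally show ?thesis using nonresonance by simp
qed

lemma \<Delta>_0: "\<Delta> 0 = of_real (4 * (c\<^sup>2 - 16 * a * (a - 3)))" "\<Delta> 0 \<noteq> 0"
proof -
  show "\<Delta> 0 = of_real (4 * (c\<^sup>2 - 16 * a * (a - 3)))"
    by (simp add: \<Delta>_def algebra_simps)
  moreover have "4 * (c\<^sup>2 - 16 * a * (a - 3)) > 0" using nonresonance_pos by (intro mult_pos_pos) simp_all
  ultimately show "\<Delta> 0 \<noteq> 0" by (metis less_irrefl of_real_eq_0_iff)
qed

lemma \<Delta>_2: "\<Delta> 2 = of_real (12 * a * (16 - 5 * a)) + \<i> * of_real (24 * \<omega> * (a + 1))" "\<Delta> 2 \<noteq> 0"
proof -
  show eq: "\<Delta> 2 = of_real (12 * a * (16 - 5 * a)) + \<i> * of_real (24 * \<omega> * (a + 1))"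
    using \<omega>_sq by (simp add: \<Delta>_def complex_eq_iff power2_eq_square algebra_simps)
  have "Im (\<Delta> 2) = 24 * \<omega> * (a + 1)" unfolding eq by simp
  also have "\<dots> \<noteq> 0" using \<omega>_pos a_pos by simp
  finally show "\<Delta> 2 \<noteq> 0" by auto
qed

text \<open>The coefficient of \<open>A \<bar>A\<bar>\<^sup>2\<close> that the monomial \<open>w\<^sup>2 cnj w\<close> of the nonlinearity contributes to the first
component of the reduced vector field.\<close>

definition cubic_scale :: complex where
  "cubic_scale = (of_real a + \<i> * of_real \<omega>) / (2 * of_real \<omega>) * (\<kappa>\<^sup>2 * cnj \<kappa>)"

lemma cubic_scale_eq: "cubic_scale = \<i> / (2 * of_real (\<omega> * c\<^sup>2))"
proof -
  have "\<kappa> * cnj \<kappa> * (of_real c)\<^sup>2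
     = (\<kappa> * (of_real a + \<i> * of_real \<omega>)) * (cnj \<kappa> * (of_real a - \<i> * of_real \<omega>))"
    unfolding a_i\<omega>(1)[symmetric] by (simp only: ac_simps)
  also have "\<dots> = 1" unfolding \<kappa>_mult by simp
  finally have "\<kappa> * cnj \<kappa> * (of_real c)\<^sup>2 = 1" .
  moreover have "c \<noteq> 0" using a_pos a_less_c by simp
  ultimately have 1: "\<kappa> * cnj \<kappa> = 1 / (of_real c)\<^sup>2" by (simp add: field_simps)
  have "cubic_scale = (\<kappa> * (of_real a + \<i> * of_real \<omega>)) * (\<kappa> * cnj \<kappa>) / (2 * of_real \<omega>)"
    by (simp add: cubic_scale_def power2_eq_square)
  then show ?thesis unfolding \<kappa>_mult 1 by simp
qed

lemma cubic_term_computed: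
  "cubic_term z = cubic_scale * (of_real \<eta> - 2 / \<Delta> 2) * (fst z * fst z * cnj (fst z))
      + cubic_scale * (2 * of_real \<eta> - 4 / \<Delta> 0) * (fst z * snd z * cnj (snd z))"
proof -
  define k where "k = (of_real a + \<i> * of_real \<omega>) / (2 * of_real \<omega> :: complex)"
  define P where "P z = cubic_scale * (of_real \<eta> - 2 / \<Delta> 2) * (fst z * fst z * cnj (fst z))
      + cubic_scale * (2 * of_real \<eta> - 4 / \<Delta> 0) * (fst z * snd z * cnj (snd z)) - cubic_term z" for z
  define E where "E n z = 1 / \<Delta> n * (\<Delta> n * average (\<lambda>z. u_hat z 2) z n + 2 * average (\<lambda>z. (w z)\<^sup>2) z n)" for n z
  have E: "average (\<lambda>z. u_hat z 2) z n = E n z - 2 / \<Delta> n * average (\<lambda>z. (w z)\<^sup>2) z n"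
    if "\<Delta> n \<noteq> 0" for n z
    using that by (simp add: E_def field_simps)
  have vE: "vanishes 3 (\<lambda>z x. E n z)" for n
    unfolding E_def by (intro vanishes_cmult second_mode_average)
  have "vanishes (1 + 3) (\<lambda>z x. cnj (snd z) * E 0 z)" "vanishes (1 + 3) (\<lambda>z x. cnj (fst z) * E 2 z)"
    by (intro vanishes_mult vE vanishes_cnj vanishes_fst vanishes_snd)+
  then have "vanishes 4 (\<lambda>z x. (k * (average (\<lambda>z. cnj (w z) * u_hat z 2) z 1
        + of_real \<eta> * average (\<lambda>z. (w z)\<^sup>2 * cnj (w z)) z 1) - cubic_term z)
      - k * (- \<kappa> * (cnj (snd z) * E 0 z) + cnj \<kappa> * (cnj (fst z) * E 2 z)))"
    by (intro vanishes_diff[OF averaged_identity[folded k_def]] vanishes_cmult vanishes_add) simp_all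
  then have "vanishes 4 (\<lambda>z x. P z)"
  proof (rule vanishes_cong_ball)
    fix z :: amplitudes assume z: "z \<in> ball 0 \<rho>"
    have m: "cubic_scale = k * (\<kappa>\<^sup>2 * cnj \<kappa>)" by (simp add: cubic_scale_def k_def)
    show "P z = (k * (average (\<lambda>z. cnj (w z) * u_hat z 2) z 1
        + of_real \<eta> * average (\<lambda>z. (w z)\<^sup>2 * cnj (w z)) z 1) - cubic_term z)
      - k * (- \<kappa> * (cnj (snd z) * E 0 z) + cnj \<kappa> * (cnj (fst z) * E 2 z))"
      unfolding average_w_u_hat[OF z] E[OF \<Delta>_0(2)] E[OF \<Delta>_2(2)] average_w_cube average_w_square P_def m
      by (simp add: power2_eq_square algebra_simps)
  qed
  then have "vanishes (Suc 3) (\<lambda>z x. P z)" by simp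
  moreover have "P (t *\<^sub>R z) = of_real t ^ 3 * P z" for t z
    by (simp add: P_def cubic_term_eq scaleR_conv_of_real power3_eq_cube algebra_simps)
  ultimately have "P z = 0" by (rule homogeneous_vanishes_eq_0)
  then show ?thesis by (simp add: P_def)
qed

lemma coefficients: "\<zeta> = cubic_scale * (of_real \<eta> - 2 / \<Delta> 2)" "\<xi> = cubic_scale * (2 * of_real \<eta> - 4 / \<Delta> 0)"
proof -
  show 1: "\<zeta> = cubic_scale * (of_real \<eta> - 2 / \<Delta> 2)"
    using cubic_term_computed[of "(1, 0)"] by (simp add: cubic_term_eq)
  show "\<xi> = cubic_scale * (2 * of_real \<eta> - 4 / \<Delta> 0)"
  proof -
    have "\<zeta> + \<xi> = cubic_scale * (of_real \<eta> - 2 / \<Delta> 2) + cubic_scale * (2 * of_real \<eta> - 4 / \<Delta> 0)"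
      using cubic_term_computed[of "(1, 1)"] by (simp add: cubic_term_eq)
    then show ?thesis unfolding 1[symmetric] by (rule add_left_imp_eq)
  qed
qed

lemma \<zeta>_formula: "\<zeta> = 1 / (12 * of_real (c\<^sup>2) *
       (of_real (2 * (a + 1) * (a\<^sup>2 - c\<^sup>2)) + \<i> * of_real (\<omega> * a * (16 - 5 * a))))
     + \<i> * of_real \<eta> / of_real (2 * c\<^sup>2 * \<omega>)"
proof -
  define D where "D = of_real (2 * (a + 1) * (a\<^sup>2 - c\<^sup>2)) + \<i> * of_real (\<omega> * a * (16 - 5 * a))"
  have c0: "c \<noteq> 0" using a_pos a_less_c by simp
  have ac: "a\<^sup>2 - c\<^sup>2 = - (\<omega> * \<omega>)" using \<omega>_sq by (simp add: power2_eq_square)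
  have D: "\<i> * of_real \<omega> * \<Delta> 2 = 12 * D"
    unfolding D_def ac \<Delta>_2(1) by (simp add: complex_eq_iff algebra_simps)
  have D0: "D \<noteq> 0" using D \<Delta>_2(2) \<omega>_pos by auto
  have "\<i> / (2 * of_real (\<omega> * c\<^sup>2)) * (2 / \<Delta> 2) = \<i> * (\<i> * of_real \<omega>) / (of_real (\<omega> * c\<^sup>2) * (\<i> * of_real \<omega> * \<Delta> 2))"
    using \<omega>_pos \<Delta>_2(2) c0 by (simp add: field_simps)
  also have "\<dots> = - (1 / (12 * of_real (c\<^sup>2) * D))"
    unfolding D using \<omega>_pos D0 c0 by (simp add: field_simps)
  finally have *: "\<i> / (2 * of_real (\<omega> * c\<^sup>2)) * (2 / \<Delta> 2) = - (1 / (12 * of_real (c\<^sup>2) * D))" .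
  show ?thesis
    unfolding D_def[symmetric] coefficients cubic_scale_eq unfolding right_diff_distrib * by (simp add: mult_ac)
qed

lemma \<xi>_formula: "\<xi> = \<i> / of_real (c\<^sup>2 * \<omega>) * of_real (\<eta> - 1 / (2 * (c\<^sup>2 - 16 * a * (a - 3))))"
proof -
  define g where "g = c\<^sup>2 - 16 * a * (a - 3)"
  have "g \<noteq> 0" using nonresonance_pos by (simp add: g_def)
  then have "2 * complex_of_real \<eta> - 4 / of_real (4 * g) = 2 * of_real (\<eta> - 1 / (2 * g))"
    by (simp add: field_simps)
  moreover have "\<i> / (2 * of_real (\<omega> * c\<^sup>2)) * (2 * x) = \<i> / of_real (c\<^sup>2 * \<omega>) * x" for x
    by (simp add: mult.commute)
  ultimately show ?thesis
    unfolding coefficients cubic_scale_eq \<Delta>_0(1) g_def[symmetric] by (simp only:)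
qed

end

lemma Re_zeta_formula:
  fixes a c \<omega> :: real
  assumes "0 < a" "a < c" "\<omega> > 0" "\<omega>\<^sup>2 = c\<^sup>2 - a\<^sup>2"
  shows "Re (1 / (12 * of_real (c\<^sup>2) *
       (of_real (2 * (a + 1) * (a\<^sup>2 - c\<^sup>2)) + \<i> * of_real (\<omega> * a * (16 - 5 * a)))))
    = - ((a + 1) / (6 * c\<^sup>2 * (a\<^sup>2 * (5 * a - 16)\<^sup>2 + 4 * (a + 1)\<^sup>2 * (c\<^sup>2 - a\<^sup>2))))"
proof -
  let ?Y = "a\<^sup>2 * (5 * a - 16)\<^sup>2 + 4 * (a + 1)\<^sup>2 * \<omega>\<^sup>2"
  define D where "D = complex_of_real (2 * (a + 1) * (a\<^sup>2 - c\<^sup>2)) + \<i> * of_real (\<omega> * a * (16 - 5 * a))"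
  have ReD: "Re D = - (2 * (a + 1) * \<omega>\<^sup>2)" by (simp add: D_def assms(4) algebra_simps)
  have "(Re D)\<^sup>2 + (Im D)\<^sup>2 = \<omega>\<^sup>2 * ?Y"
    unfolding ReD by (simp add: D_def power2_eq_square algebra_simps)
  then have "Re (1 / D) = - (2 * (a + 1) * \<omega>\<^sup>2) / (\<omega>\<^sup>2 * ?Y)"
    unfolding Re_divide ReD by simp
  also have "\<dots> = - (2 * (a + 1)) / ?Y"
    using assms(3) by (subst mult.commute[of "\<omega>\<^sup>2" ?Y], subst minus_mult_left,
      subst nonzero_mult_divide_mult_cancel_right) simp_all
  finally have "Re (1 / D) = - (2 * (a + 1)) / ?Y" .
  moreover have "Re (1 / (12 * of_real (c\<^sup>2) * D)) = 1 / (12 * c\<^sup>2) * Re (1 / D)"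
  proof -
    have "1 / (12 * of_real (c\<^sup>2) * D) = of_real (1 / (12 * c\<^sup>2)) * (1 / D)" by simp
    then show ?thesis by (simp only: Re_complex_of_real times_complex.simps Im_complex_of_real)
  qed
  moreover have "1 / (12 * c\<^sup>2) * (- (2 * (a + 1)) / y) = - ((a + 1) / (6 * c\<^sup>2 * y))" for y
    using assms(1,2) by (cases "y = 0") (simp_all add: field_simps)
  ultimately show ?thesis
    unfolding D_def[symmetric] assms(4)[symmetric] by (simp only:)
qed


section \<open>Type of the waves\<close>

text \<open>Since \<open>Re \<xi> = 0\<close>, the amplitude equations decouple and the Jacobian is diagonal.\<close>

lemma amplitude_field_derivative:
  assumes "Re \<xi> = 0"
  shows "(amplitude_field b \<zeta> \<xi> has_derivative
     (\<lambda>h. vector [(b + 3 * Re \<zeta> * (p $ 1)\<^sup>2) * h $ 1, (b + 3 * Re \<zeta> * (p $ 2)\<^sup>2) * h $ 2])) (at p)"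
proof -
  have v: "vector [x, y] = x *\<^sub>R axis 1 1 + y *\<^sub>R (axis 2 1 :: real^2)" for x y :: real
    by (simp add: vec_eq_iff forall_2 axis_def)
  have nth: "((\<lambda>r::real^2. r $ i) has_derivative (\<lambda>h. h $ i)) (at p)" for i
    by (rule bounded_linear_imp_has_derivative[OF bounded_linear_vec_nth])
  have "amplitude_field b \<zeta> \<xi> = (\<lambda>r. (b * r $ 1 + Re \<zeta> * (r $ 1) ^ 3) *\<^sub>R axis 1 1
      + (b * r $ 2 + Re \<zeta> * (r $ 2) ^ 3) *\<^sub>R (axis 2 1 :: real^2))"
    unfolding amplitude_field_def v using assms by (simp add: fun_eq_iff power2_eq_square power3_eq_cube mult_ac)
  moreover have "((\<lambda>r. (b * r $ 1 + Re \<zeta> * (r $ 1) ^ 3) *\<^sub>R axis 1 1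
      + (b * r $ 2 + Re \<zeta> * (r $ 2) ^ 3) *\<^sub>R (axis 2 1 :: real^2)) has_derivative
     (\<lambda>h. ((b + 3 * Re \<zeta> * (p $ 1)\<^sup>2) * h $ 1) *\<^sub>R axis 1 1
         + ((b + 3 * Re \<zeta> * (p $ 2)\<^sup>2) * h $ 2) *\<^sub>R (axis 2 1 :: real^2))) (at p)"
    by (rule derivative_eq_intros nth refl)+ (simp add: algebra_simps power2_eq_square)
  ultimately show ?thesis unfolding v by simp
qed

lemma amplitude_spectrum:
  assumes "Re \<xi> = 0"
  shows "linearization_spectrum (amplitude_field b \<zeta> \<xi>) p =
     {of_real (b + 3 * Re \<zeta> * (p $ 1)\<^sup>2), of_real (b + 3 * Re \<zeta> * (p $ 2)\<^sup>2)}"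
proof -
  define d1 d2 where d: "d1 = b + 3 * Re \<zeta> * (p $ 1)\<^sup>2" "d2 = b + 3 * Re \<zeta> * (p $ 2)\<^sup>2"
  have fd: "frechet_derivative (amplitude_field b \<zeta> \<xi>) (at p) = (\<lambda>h. vector [d1 * h $ 1, d2 * h $ 2])"
    using frechet_derivative_at[OF amplitude_field_derivative[OF assms]] by (simp add: d)
  have mat: "map_matrix of_real (matrix (\<lambda>h::real^2. vector [d1 * h $ 1, d2 * h $ 2] :: real^2)) *v x
      = vector [of_real d1 * x $ 1, of_real d2 * x $ 2]" for x :: "complex^2"
    by (simp add: vec_eq_iff forall_2 matrix_vector_mult_def sum_2 matrix_def map_matrix_def axis_def)
  have "eigenvalue (map_matrix of_real (matrix (\<lambda>h::real^2. vector [d1 * h $ 1, d2 * h $ 2] :: real^2))) \<mu>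
     \<longleftrightarrow> \<mu> = of_real d1 \<or> \<mu> = of_real d2" (is "?L \<longleftrightarrow> ?R") for \<mu> :: complex
  proof
    assume ?L
    then obtain x :: "complex^2" where "x \<noteq> 0" "of_real d1 * x $ 1 = \<mu> * x $ 1" "of_real d2 * x $ 2 = \<mu> * x $ 2"
      unfolding eigenvalue_def mat by (auto simp: vec_eq_iff forall_2)
    then show ?R by (auto simp: vec_eq_iff forall_2)
  next
    assume ?R
    then show ?L
    proof
      assume "\<mu> = of_real d1"
      then show ?L unfolding eigenvalue_def mat
        by (intro exI[of _ "vector [1, 0]"]) (simp add: vec_eq_iff forall_2)
    next
      assume "\<mu> = of_real d2"
      then show ?L unfolding eigenvalue_def mat
        by (intro exI[of _ "vector [0, 1]"]) (simp add: vec_eq_iff forall_2)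
    qed
  qed
  then show ?thesis unfolding linearization_spectrum_def fd d[symmetric] by auto
qed

text \<open>With \<open>b = Re \<beta>\<close> positive, the nonzero amplitude is attracting with rate \<open>-2b\<close>, while the vanishing one
grows with rate \<open>b\<close>.\<close>

lemma traveling_wave_saddle:
  assumes "Re \<zeta> < 0" "Re \<xi> = 0" "traveling_wave a c \<delta> \<zeta> \<xi> r \<theta>"
  shows "saddle_traveling_wave a c \<delta> \<zeta> \<xi> r"
proof -
  define b where "b = Re (beta1 a c \<delta>)"
  have r: "r > 0" "r\<^sup>2 = - b / Re \<zeta>" using assms(3) by (auto simp: traveling_wave_def b_def)
  then have b: "b = - Re \<zeta> * r\<^sup>2" using assms(1) by (simp add: field_simps)
  then have "b > 0" using r(1) assms(1) by (simp add: mult_neg_pos)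
  moreover have "amplitude_field b \<zeta> \<xi> (vector [r, 0]) = 0"
    using assms(2) by (simp add: amplitude_field_def vec_eq_iff forall_2 b algebra_simps)
  moreover have "amplitude_field b \<zeta> \<xi> differentiable (at (vector [r, 0]))"
    using amplitude_field_derivative[OF assms(2)] by (auto simp: differentiable_def)
  moreover have "linearization_spectrum (amplitude_field b \<zeta> \<xi>) (vector [r, 0]) = {of_real (- 2 * b), of_real b}"
    unfolding amplitude_spectrum[OF assms(2)] by (simp add: b)
  ultimately show ?thesis
    unfolding saddle_traveling_wave_def saddle_def b_def[symmetric] by simp
qed

lemma standing_wave_stable:
  assumes "Re \<zeta> < 0" "Re \<xi> = 0" "standing_wave a c \<delta> \<zeta> \<xi> r \<theta>"
  shows "stable_standing_wave a c \<delta> \<zeta> \<xi> r"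
proof -
  define b where "b = Re (beta1 a c \<delta>)"
  have r: "r > 0" "r\<^sup>2 = - b / Re \<zeta>" using assms(2,3) by (auto simp: standing_wave_def b_def)
  then have b: "b = - Re \<zeta> * r\<^sup>2" using assms(1) by (simp add: field_simps)
  then have "b > 0" using r(1) assms(1) by (simp add: mult_neg_pos)
  moreover have "amplitude_field b \<zeta> \<xi> (vector [r, r]) = 0"
    using assms(2) by (simp add: amplitude_field_def vec_eq_iff forall_2 b algebra_simps)
  moreover have "amplitude_field b \<zeta> \<xi> differentiable (at (vector [r, r]))"
    using amplitude_field_derivative[OF assms(2)] by (auto simp: differentiable_def)
  moreover have "linearization_spectrum (amplitude_field b \<zeta> \<xi>) (vector [r, r]) = {of_real (- 2 * b)}"
    unfolding amplitude_spectrum[OF assms(2)] by (simp add: b)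
  ultimately show ?thesis
    unfolding stable_standing_wave_def stable_def b_def[symmetric] by simp
qed

theorem mainTheorem5:
  fixes a c \<eta> \<delta>c \<omega> :: real and \<zeta> \<xi> :: complex
  assumes "0 < a" and "a < c" and "c\<^sup>2 > 4 * a * (a + 1) ^ 3 / 27"
    and "\<delta>c = a + 1" and "\<omega> = sqrt (c\<^sup>2 - a\<^sup>2)"
    and "O2_Hopf_coefficients a c \<eta> \<delta>c \<zeta> \<xi>"
  shows "\<zeta> = 1 / (12 * of_real (c\<^sup>2) *
               (of_real (2 * (a + 1) * (a\<^sup>2 - c\<^sup>2)) + \<i> * of_real (\<omega> * a * (16 - 5 * a))))
             + \<i> * of_real \<eta> / of_real (2 * c\<^sup>2 * \<omega>) \<and>
         \<xi> = \<i> / of_real (c\<^sup>2 * \<omega>) * of_real (\<eta> - 1 / (2 * (c\<^sup>2 - 16 * a * (a - 3)))) \<and>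
         Re \<zeta> = - ((a + 1) / (6 * c\<^sup>2 * (a\<^sup>2 * (5 * a - 16)\<^sup>2 + 4 * (a + 1)\<^sup>2 * (c\<^sup>2 - a\<^sup>2)))) \<and>
         Re \<zeta> < 0 \<and> Re \<xi> = 0 \<and> Re \<zeta> + Re \<xi> < 0 \<and> Re \<zeta> - Re \<xi> < 0 \<and>
         (\<forall>\<^sub>F \<delta> in nhds \<delta>c.
            (\<forall>r \<theta>. traveling_wave a c \<delta> \<zeta> \<xi> r \<theta> \<longrightarrow> saddle_traveling_wave a c \<delta> \<zeta> \<xi> r) \<and>
            (\<forall>r \<theta>. standing_wave a c \<delta> \<zeta> \<xi> r \<theta> \<longrightarrow> stable_standing_wave a c \<delta> \<zeta> \<xi> r))"
proof -
  obtain \<rho> U V \<Theta> where "\<rho> > 0" "center_manifold a c \<eta> (a + 1) 5 \<rho> U V"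
    "near_identity_equivariant (a + 1) 5 \<rho> \<Theta>" "brings_into_normal_form a c \<eta> (a + 1) \<rho> U V \<Theta> \<zeta> \<xi>"
    using assms(4,6) unfolding O2_Hopf_coefficients_def by blast
  then interpret critical_reduction a c \<eta> \<omega> \<rho> U V \<Theta> \<zeta> \<xi>
    using assms by unfold_locales
  have Re\<zeta>: "Re \<zeta> = - ((a + 1) / (6 * c\<^sup>2 * (a\<^sup>2 * (5 * a - 16)\<^sup>2 + 4 * (a + 1)\<^sup>2 * (c\<^sup>2 - a\<^sup>2))))"
  proof -
    have "Re (\<i> * of_real \<eta> / of_real (2 * c\<^sup>2 * \<omega>)) = 0"
      by (simp only: Re_divide_of_real) simp
    then show ?thesis
      by (subst \<zeta>_formula) (simp only: plus_complex.simps Re_zeta_formula[OF a_pos a_less_c \<omega>_pos \<omega>_sq] add_0_right)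
  qed
  have "(a + 1)\<^sup>2 * (c\<^sup>2 - a\<^sup>2) > 0" using a_pos \<omega>_pos \<omega>_sq by (metis add_pos_pos mult_pos_pos zero_less_one zero_less_power)
  then have "a\<^sup>2 * (5 * a - 16)\<^sup>2 + 4 * (a + 1)\<^sup>2 * (c\<^sup>2 - a\<^sup>2) > 0"
    unfolding mult.assoc[of 4] by (intro add_nonneg_pos) simp_all
  then have neg: "Re \<zeta> < 0"
    unfolding Re\<zeta> neg_less_0_iff_less using a_pos a_less_c by (intro divide_pos_pos mult_pos_pos) simp_all
  have im: "Re \<xi> = 0"
    unfolding \<xi>_formula by (simp only: times_complex.simps Re_divide_of_real) simp
  show ?thesis
    using \<zeta>_formula \<xi>_formula Re\<zeta> neg im traveling_wave_saddle[OF neg im] standing_wave_stable[OF neg im]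
    by simp
qed

end
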